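(* For a nil$_2$-group $G$ there is a well-defined element $o(G)\in\mathsf{Quad}^1(G^{\mathrm{ab}},[G,G])$ (the image of the identity of $G^{\mathrm{ab}}$ under the connecting map $\mathrm{Hom}(G^{\mathrm{ab}},G^{\mathrm{ab}})\to\mathsf{Quad}^1(G^{\mathrm{ab}},[G,G])$) which vanishes if and only if $G$ is q-split.
   Context: Groups are written additively; $[a,b]=-a-b+a+b$. A nil$_2$-group is a group $G$ with $[[G,G],G]=0$; $\mathbf{Nil}$ is the category of nil$_2$-groups and homomorphisms; $G^{\mathrm{ab}}=G/[G,G]$. For a map $f:G\to H$ put $(a\mid b)_f:=-(f(a)+f(b))+f(a+b)$. The map $f$ is weakly quadratic if for all $a,b,c\in G$ the element $(a\mid b)_f$ commutes with $f(c)$ and is additive in $a$ and in $b$; it is quadratic if moreover $(a\mid b)_f$ is central in $H$. $\mathsf{Quad}(G,H)$ is the set of quadratic maps, a group under pointwise addition for $H$ nil$_2$ (abelian if $H$ is abelian). A q-map is a weakly quadratic map $f:G\to H$ between nil$_2$-groups with $(a\mid b)_f\in[H,H]$ for all $a,b$; $\mathsf Q(G,H)$ is the group of q-maps under pointwise addition. A nil$_2$-group $G$ is q-split if the quotient map $G\to G^{\mathrm{ab}}$ has a quadratic section (which is then a q-map). A free simplicial resolution of $K\in\mathbf{Nil}$ is a simplicial object $K_*$ in $\mathbf{Nil}$ with every $K_n$ free in $\mathbf{Nil}$, $\pi_i(K_* )=0$ for $i>0$ and $\pi_0(K_* )=K$. For an abelian group $A$, $\mathsf{Quad}^i(K,A):=\pi^i(\mathsf{Quad}(K_*,A))$,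 the $i$-th cohomology of the cochain complex (differential $\sum(-1)^jd^j$) of the cosimplicial abelian group $\mathsf{Quad}(K_*,A)$; it does not depend on the choice of $K_*$. For nil$_2$-groups $K,H$ the connecting map $\mathrm{Hom}(K,H^{\mathrm{ab}})\to\mathsf{Quad}^1(K,[H,H])$ arises from the short exact sequence of cosimplicial groups $0\to\mathsf{Quad}(K_*,[H,H])\to\mathsf Q(K_*,H)\to\mathrm{Hom}(K_*,H^{\mathrm{ab}})\to0$: given $f:K\to H^{\mathrm{ab}}$, choose a q-map $\varphi:K_0\to H$ lifting the composite $K_0\to K\xrightarrow{f}H^{\mathrm{ab}}$; with $d_0,d_1:K_1\to K_0$ the face maps, $-\varphi d_0+\varphi d_1$ takes values in $[H,H]$ and its class is the image of $f$. It is applied here with $K=G^{\mathrm{ab}}$, $H=G$, $f=\mathrm{id}$. *)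

theory Defs
  imports "HOL-Algebra.Generated_Groups" "HOL-Algebra.FiniteProduct"
begin

text \<open>Groups are written multiplicatively, following HOL-Algebra.\<close>

section \<open>Groups of nilpotency class two and quadratic maps\<close>

definition comm :: "('a, 'm) monoid_scheme \<Rightarrow> 'a \<Rightarrow> 'a \<Rightarrow> 'a" where
  "comm G a b = inv\<^bsub>G\<^esub> a \<otimes>\<^bsub>G\<^esub> inv\<^bsub>G\<^esub> b \<otimes>\<^bsub>G\<^esub> a \<otimes>\<^bsub>G\<^esub> b"

definition nil2 :: "('a, 'm) monoid_scheme \<Rightarrow> bool" where
  "nil2 G \<longleftrightarrow> group G \<and>
     (\<forall>x\<in>derived G (carrier G). \<forall>g\<in>carrier G. comm G x g = \<one>\<^bsub>G\<^esub>)"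

definition abel :: "'a monoid \<Rightarrow> 'a set monoid" where
  "abel G = G Mod derived G (carrier G)"

definition abel_proj :: "'a monoid \<Rightarrow> 'a \<Rightarrow> 'a set" where
  "abel_proj G x = derived G (carrier G) #>\<^bsub>G\<^esub> x"

definition derived_group :: "'a monoid \<Rightarrow> 'a monoid" where
  "derived_group G = G\<lparr>carrier := derived G (carrier G)\<rparr>"

text \<open>The cross effect \<open>(a | b)\<^sub>f = - (f a + f b) + f (a + b)\<close>.\<close>

definition cross :: "'a monoid \<Rightarrow> 'b monoid \<Rightarrow> ('a \<Rightarrow> 'b) \<Rightarrow> 'a \<Rightarrow> 'a \<Rightarrow> 'b" where
  "cross G H f a b = inv\<^bsub>H\<^esub> (f a \<otimes>\<^bsub>H\<^esub> f b) \<otimes>\<^bsub>H\<^esub> f (a \<otimes>\<^bsub>G\<^esub> b)"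

definition weakly_quadratic :: "'a monoid \<Rightarrow> 'b monoid \<Rightarrow> ('a \<Rightarrow> 'b) \<Rightarrow> bool" where
  "weakly_quadratic G H f \<longleftrightarrow> f \<in> carrier G \<rightarrow> carrier H \<and>
     (\<forall>a\<in>carrier G. \<forall>b\<in>carrier G. \<forall>c\<in>carrier G.
        cross G H f a b \<otimes>\<^bsub>H\<^esub> f c = f c \<otimes>\<^bsub>H\<^esub> cross G H f a b \<and>
        cross G H f (a \<otimes>\<^bsub>G\<^esub> b) c = cross G H f a c \<otimes>\<^bsub>H\<^esub> cross G H f b c \<and>
        cross G H f a (b \<otimes>\<^bsub>G\<^esub> c) = cross G H f a b \<otimes>\<^bsub>H\<^esub> cross G H f a c)"

definition quadratic :: "'a monoid \<Rightarrow> 'b monoid \<Rightarrow> ('a \<Rightarrow> 'b) \<Rightarrow> bool" where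
  "quadratic G H f \<longleftrightarrow> weakly_quadratic G H f \<and>
     (\<forall>a\<in>carrier G. \<forall>b\<in>carrier G. \<forall>h\<in>carrier H.
        cross G H f a b \<otimes>\<^bsub>H\<^esub> h = h \<otimes>\<^bsub>H\<^esub> cross G H f a b)"

definition q_map :: "'a monoid \<Rightarrow> 'b monoid \<Rightarrow> ('a \<Rightarrow> 'b) \<Rightarrow> bool" where
  "q_map G H f \<longleftrightarrow> nil2 G \<and> nil2 H \<and> weakly_quadratic G H f \<and>
     (\<forall>a\<in>carrier G. \<forall>b\<in>carrier G. cross G H f a b \<in> derived H (carrier H))"

definition q_split :: "'a monoid \<Rightarrow> bool" where
  "q_split G \<longleftrightarrow> nil2 G \<and>
     (\<exists>s. quadratic (abel G) G s \<and> (\<forall>c\<in>carrier (abel G). abel_proj G (s c) = c))"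

text \<open>Extensionality off the carrier makes equality in this group the equality of maps
  \<open>carrier G \<rightarrow> carrier H\<close>.\<close>

definition quad_group :: "'a monoid \<Rightarrow> 'b monoid \<Rightarrow> ('a \<Rightarrow> 'b) monoid" where
  "quad_group G H =
     \<lparr>carrier = {f \<in> extensional (carrier G). quadratic G H f},
      mult = (\<lambda>f g. \<lambda>x\<in>carrier G. f x \<otimes>\<^bsub>H\<^esub> g x),
      one = (\<lambda>x\<in>carrier G. \<one>\<^bsub>H\<^esub>)\<rparr>"

text \<open>Freeness on a subset is the universal property in the category of nil-2 groups. HOL cannot
  quantify over all target types; testing against groups whose elements are signed words in \<open>'k\<close>
  suffices. Indeed every group generated by the image of a subset of \<open>'k\<close> has at most as many
  elements as there are such words, so an isomorphic copy of it is among the test groups. This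
  covers the free nil-2 group on \<open>X\<close> itself and, for an arbitrary nil-2 target \<open>H\<close>, the subgroup of
  \<open>H\<close> generated by the image of \<open>X\<close>.\<close>

definition free_nil2_on :: "'k set \<Rightarrow> 'k monoid \<Rightarrow> bool" where
  "free_nil2_on X F \<longleftrightarrow> X \<subseteq> carrier F \<and>
     (\<forall>(H :: ('k \<times> bool) list monoid) f. nil2 H \<longrightarrow> f \<in> X \<rightarrow> carrier H \<longrightarrow>
        (\<exists>!h. h \<in> hom F H \<and> h \<in> extensional (carrier F) \<and> (\<forall>x\<in>X. h x = f x)))"

definition free_nil2 :: "'k monoid \<Rightarrow> bool" where
  "free_nil2 F \<longleftrightarrow> nil2 F \<and> (\<exists>X. free_nil2_on X F)"


section \<open>Simplicial groups and free simplicial resolutions\<close>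

text \<open>\<open>face S n i\<close> is \<open>d\<^sub>i : K\<^sub>n\<^sub>+\<^sub>1 \<rightarrow> K\<^sub>n\<close> (indexed by the degree of its target) and \<open>degen S n i\<close> is
  \<open>s\<^sub>i : K\<^sub>n \<rightarrow> K\<^sub>n\<^sub>+\<^sub>1\<close> (indexed by the degree of its source).\<close>

record 'k simp_grp =
  grp :: "nat \<Rightarrow> 'k monoid"
  face :: "nat \<Rightarrow> nat \<Rightarrow> 'k \<Rightarrow> 'k"
  degen :: "nat \<Rightarrow> nat \<Rightarrow> 'k \<Rightarrow> 'k"

definition simplicial_nil2 :: "'k simp_grp \<Rightarrow> bool" where
  "simplicial_nil2 S \<longleftrightarrow>
     (\<forall>n. nil2 (grp S n)) \<and>
     (\<forall>n. \<forall>i\<le>Suc n. face S n i \<in> hom (grp S (Suc n)) (grp S n)) \<and>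
     (\<forall>n. \<forall>i\<le>n. degen S n i \<in> hom (grp S n) (grp S (Suc n))) \<and>
     (\<forall>n. \<forall>j\<le>Suc (Suc n). \<forall>i<j. \<forall>x\<in>carrier (grp S (Suc (Suc n))).
        face S n i (face S (Suc n) j x) = face S n (j - 1) (face S (Suc n) i x)) \<and>
     (\<forall>n. \<forall>j\<le>n. \<forall>i\<le>j. \<forall>x\<in>carrier (grp S n).
        degen S (Suc n) i (degen S n j x) = degen S (Suc n) (Suc j) (degen S n i x)) \<and>
     (\<forall>n. \<forall>j\<le>Suc n. \<forall>i<j. \<forall>x\<in>carrier (grp S (Suc n)).
        face S (Suc n) i (degen S (Suc n) j x) = degen S n (j - 1) (face S n i x)) \<and>
     (\<forall>n. \<forall>j\<le>n. \<forall>x\<in>carrier (grp S n).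
        face S n j (degen S n j x) = x \<and> face S n (Suc j) (degen S n j x) = x) \<and>
     (\<forall>n. \<forall>j\<le>Suc n. \<forall>i\<le>Suc (Suc n). Suc j < i \<longrightarrow> (\<forall>x\<in>carrier (grp S (Suc n)).
        face S (Suc n) i (degen S (Suc n) j x) = degen S n j (face S n (i - 1) x)))"

text \<open>Homotopy groups via the Moore complex: \<open>N\<^sub>n\<close> is the intersection of the kernels of all faces
  except the last one, which serves as the boundary \<open>N\<^sub>n \<rightarrow> N\<^sub>n\<^sub>-\<^sub>1\<close>.\<close>

definition moore_cycles :: "'k simp_grp \<Rightarrow> nat \<Rightarrow> 'k set" where
  "moore_cycles S n = {x \<in> carrier (grp S n).
     \<forall>m. n = Suc m \<longrightarrow> (\<forall>i\<le>n. face S m i x = \<one>\<^bsub>grp S m\<^esub>)}"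

definition moore_boundaries :: "'k simp_grp \<Rightarrow> nat \<Rightarrow> 'k set" where
  "moore_boundaries S n = face S n (Suc n) `
     {x \<in> carrier (grp S (Suc n)). \<forall>i\<le>n. face S n i x = \<one>\<^bsub>grp S n\<^esub>}"

definition homotopy_grp :: "'k simp_grp \<Rightarrow> nat \<Rightarrow> 'k set monoid" where
  "homotopy_grp S n = (grp S n)\<lparr>carrier := moore_cycles S n\<rparr> Mod moore_boundaries S n"

text \<open>A resolution comes with its identification \<open>\<theta> : \<pi>\<^sub>0(K\<^sub>*) \<rightarrow> K\<close>; composed with the projection from
  \<open>K\<^sub>0\<close> it gives the augmentation.\<close>

definition free_resolution :: "'k simp_grp \<Rightarrow> ('k set \<Rightarrow> 'c) \<Rightarrow> 'c monoid \<Rightarrow> bool" where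
  "free_resolution S \<theta> K \<longleftrightarrow> simplicial_nil2 S \<and> (\<forall>n. free_nil2 (grp S n)) \<and>
     (\<forall>i>0. carrier (homotopy_grp S i) = {\<one>\<^bsub>homotopy_grp S i\<^esub>}) \<and>
     \<theta> \<in> iso (homotopy_grp S 0) K"

definition aug :: "'k simp_grp \<Rightarrow> ('k set \<Rightarrow> 'c) \<Rightarrow> 'k \<Rightarrow> 'c" where
  "aug S \<theta> x = \<theta> (moore_boundaries S 0 #>\<^bsub>grp S 0\<^esub> x)"

definition simp_map :: "'k simp_grp \<Rightarrow> 'l simp_grp \<Rightarrow> (nat \<Rightarrow> 'k \<Rightarrow> 'l) \<Rightarrow> bool" where
  "simp_map S T g \<longleftrightarrow>
     (\<forall>n. g n \<in> hom (grp S n) (grp T n)) \<and>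
     (\<forall>n. \<forall>i\<le>Suc n. \<forall>x\<in>carrier (grp S (Suc n)).
        face T n i (g (Suc n) x) = g n (face S n i x)) \<and>
     (\<forall>n. \<forall>i\<le>n. \<forall>x\<in>carrier (grp S n).
        degen T n i (g n x) = g (Suc n) (degen S n i x))"


section \<open>Cohomology with quadratic cochains\<close>

definition quad_coface :: "'k simp_grp \<Rightarrow> nat \<Rightarrow> nat \<Rightarrow> ('k \<Rightarrow> 'a) \<Rightarrow> 'k \<Rightarrow> 'a" where
  "quad_coface S n j f = (\<lambda>x\<in>carrier (grp S (Suc n)). f (face S n j x))"

definition quad_diff :: "'k simp_grp \<Rightarrow> 'a monoid \<Rightarrow> nat \<Rightarrow> ('k \<Rightarrow> 'a) \<Rightarrow> 'k \<Rightarrow> 'a" where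
  "quad_diff S A n f =
     finprod (quad_group (grp S (Suc n)) A)
       (\<lambda>j. quad_coface S n j f [^]\<^bsub>quad_group (grp S (Suc n)) A\<^esub> ((- 1) ^ j :: int)) {..Suc n}"

definition quad_cocycles :: "'k simp_grp \<Rightarrow> 'a monoid \<Rightarrow> nat \<Rightarrow> ('k \<Rightarrow> 'a) set" where
  "quad_cocycles S A n =
     kernel (quad_group (grp S n) A) (quad_group (grp S (Suc n)) A) (quad_diff S A n)"

definition quad_coboundaries :: "'k simp_grp \<Rightarrow> 'a monoid \<Rightarrow> nat \<Rightarrow> ('k \<Rightarrow> 'a) set" where
  "quad_coboundaries S A n =
     (case n of 0 \<Rightarrow> {\<one>\<^bsub>quad_group (grp S 0) A\<^esub>}
      | Suc m \<Rightarrow> quad_diff S A m ` carrier (quad_group (grp S m) A))"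

definition quad_coh :: "'k simp_grp \<Rightarrow> 'a monoid \<Rightarrow> nat \<Rightarrow> ('k \<Rightarrow> 'a) set monoid" where
  "quad_coh S A n =
     (quad_group (grp S n) A)\<lparr>carrier := quad_cocycles S A n\<rparr> Mod quad_coboundaries S A n"

definition quad_class :: "'k simp_grp \<Rightarrow> 'a monoid \<Rightarrow> nat \<Rightarrow> ('k \<Rightarrow> 'a) \<Rightarrow> ('k \<Rightarrow> 'a) set" where
  "quad_class S A n z = quad_coboundaries S A n #>\<^bsub>quad_group (grp S n) A\<^esub> z"

text \<open>The map \<open>Quad\<^sup>n(T, A) \<rightarrow> Quad\<^sup>n(S, A)\<close> induced by a simplicial map \<open>g : S \<rightarrow> T\<close>; the union over the
  representatives of a class is a single class.\<close>

definition quad_coh_map ::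
  "'k simp_grp \<Rightarrow> 'a monoid \<Rightarrow> (nat \<Rightarrow> 'k \<Rightarrow> 'l) \<Rightarrow> nat \<Rightarrow> ('l \<Rightarrow> 'a) set \<Rightarrow> ('k \<Rightarrow> 'a) set" where
  "quad_coh_map S A g n C =
     (\<Union>z\<in>C. quad_class S A n (\<lambda>x\<in>carrier (grp S n). z (g n x)))"


section \<open>The connecting map and the obstruction\<close>

definition q_lifts ::
  "'k simp_grp \<Rightarrow> ('k set \<Rightarrow> 'c) \<Rightarrow> 'a monoid \<Rightarrow> ('c \<Rightarrow> 'a set) \<Rightarrow> ('k \<Rightarrow> 'a) set" where
  "q_lifts S \<theta> H f = {\<phi>. q_map (grp S 0) H \<phi> \<and>
     (\<forall>x\<in>carrier (grp S 0). abel_proj H (\<phi> x) = f (aug S \<theta> x))}"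

definition lift_diff :: "'k simp_grp \<Rightarrow> 'a monoid \<Rightarrow> ('k \<Rightarrow> 'a) \<Rightarrow> 'k \<Rightarrow> 'a" where
  "lift_diff S H \<phi> =
     (\<lambda>x\<in>carrier (grp S 1). inv\<^bsub>H\<^esub> \<phi> (face S 0 0 x) \<otimes>\<^bsub>H\<^esub> \<phi> (face S 0 1 x))"

text \<open>All classes obtained from the possible choices of a lift. The connecting map sends \<open>f\<close> to the
  unique element of this set; \<open>the_elem\<close> is meaningful only once the set is known to be a
  singleton.\<close>

definition connecting_values ::
  "'k simp_grp \<Rightarrow> ('k set \<Rightarrow> 'c) \<Rightarrow> 'a monoid \<Rightarrow> ('c \<Rightarrow> 'a set) \<Rightarrow> ('k \<Rightarrow> 'a) set set" where
  "connecting_values S \<theta> H f =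
     (\<lambda>\<phi>. quad_class S (derived_group H) 1 (lift_diff S H \<phi>)) ` q_lifts S \<theta> H f"

definition connecting ::
  "'k simp_grp \<Rightarrow> ('k set \<Rightarrow> 'c) \<Rightarrow> 'a monoid \<Rightarrow> ('c \<Rightarrow> 'a set) \<Rightarrow> ('k \<Rightarrow> 'a) set" where
  "connecting S \<theta> H f = the_elem (connecting_values S \<theta> H f)"

definition obstruction ::
  "'k simp_grp \<Rightarrow> ('k set \<Rightarrow> 'a set) \<Rightarrow> 'a monoid \<Rightarrow> ('k \<Rightarrow> 'a) set" where
  "obstruction S \<theta> G = connecting S \<theta> G id"

end

theory Submission
  imports Defs "HOL-Algebra.Weak_Morphisms"
begin

text \<open>For a q-map \<open>\<phi>\<close> lifting the augmentation \<open>\<epsilon> : K\<^sub>0 \<rightarrow> G\<^sup>a\<^sup>b\<close>, every other lift is \<open>\<phi> + \<alpha>\<close> with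
  \<open>\<alpha>\<close> in \<open>Quad(K\<^sub>0, [G,G])\<close>, and replacing \<open>\<phi>\<close> by \<open>\<phi> + \<alpha>\<close> changes \<open>- \<phi> d\<^sub>0 + \<phi> d\<^sub>1\<close> by the coboundary of \<open>\<alpha>\<close>.
  So the class vanishes iff some lift satisfies \<open>\<phi> d\<^sub>0 = \<phi> d\<^sub>1\<close>. Since \<open>\<epsilon>\<close> is the coequalizer of
  \<open>d\<^sub>0\<close> and \<open>d\<^sub>1\<close> already on underlying sets, such a lift is \<open>s \<circ> \<epsilon>\<close> for a quadratic section \<open>s\<close>.
  A lift exists, and can be taken to be a homomorphism, because \<open>K\<^sub>0\<close> is free.\<close>

section \<open>Groups of nilpotency class two\<close>

locale nil2_group = group G for G :: "'a monoid" (structure) +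
  assumes nil2: "nil2 G"
begin

abbreviation D where "D \<equiv> derived G (carrier G)"

lemma derived_subgroup: "subgroup D G"
  using derived_is_subgroup by simp

lemma derived_closed [simp]: "x \<in> D \<Longrightarrow> x \<in> carrier G"
  using subgroup.subset[OF derived_subgroup] by auto

lemma derived_one [simp]: "\<one> \<in> D"
  and derived_mult [simp]: "x \<in> D \<Longrightarrow> y \<in> D \<Longrightarrow> x \<otimes> y \<in> D"
  and derived_inv [simp]: "x \<in> D \<Longrightarrow> inv x \<in> D"
  using derived_subgroup
  by (auto simp: subgroup.one_closed subgroup.m_closed subgroup.m_inv_closed)

lemma derived_central:
  assumes "x \<in> D" and "g \<in> carrier G"
  shows "x \<otimes> g = g \<otimes> x"
proof -
  have x: "x \<in> carrier G" using assms(1) by simp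
  have "inv (g \<otimes> x) \<otimes> (x \<otimes> g) = \<one>"
    using nil2 assms x unfolding nil2_def comm_def by (simp add: inv_mult_group m_assoc)
  then show ?thesis
    using x assms(2) by (metis inv_equality inv_inv inv_closed m_closed)
qed

text \<open>With \<open>m_assoc\<close> and \<open>derived_central\<close> this lets the simplifier
  move factors from \<open>D\<close> to the left through right-nested products.\<close>

lemma derived_lcomm:
  assumes "x \<in> D" and "g \<in> carrier G" and "h \<in> carrier G"
  shows "g \<otimes> (x \<otimes> h) = x \<otimes> (g \<otimes> h)"
  using assms by (simp add: m_assoc[symmetric] derived_central[of x g])

lemma abel_proj_hom: "abel_proj G \<in> hom G (abel G)"
  unfolding abel_def abel_proj_def
  using normal.r_coset_hom_Mod[OF derived_self_is_normal] .

lemma abel_proj_surj: "abel_proj G ` carrier G = carrier (abel G)"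
  by (simp add: abel_def abel_proj_def carrier_FactGroup)

lemma comm_group_abel: "comm_group (abel G)"
  unfolding abel_def using derived_quot_is_comm_group .

lemma group_hom_abel_proj: "group_hom G (abel G) (abel_proj G)"
  using abel_proj_hom comm_group_abel is_group
  by (simp add: group_hom_def group_hom_axioms_def comm_group_def)

lemma abel_proj_eq_one_iff:
  assumes "x \<in> carrier G"
  shows "abel_proj G x = \<one>\<^bsub>abel G\<^esub> \<longleftrightarrow> x \<in> D"
  using coset_join1[OF _ assms derived_subgroup] coset_join2[OF assms derived_subgroup]
  by (auto simp: abel_proj_def abel_def)

lemma abel_proj_eq_iff:
  assumes "x \<in> carrier G" and "y \<in> carrier G"
  shows "abel_proj G x = abel_proj G y \<longleftrightarrow> inv x \<otimes> y \<in> D"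
proof -
  interpret p: group_hom G "abel G" "abel_proj G" by (rule group_hom_abel_proj)
  have "abel_proj G (inv x \<otimes> y) = inv\<^bsub>abel G\<^esub> abel_proj G x \<otimes>\<^bsub>abel G\<^esub> abel_proj G y"
    using assms by simp
  then have "inv x \<otimes> y \<in> D \<longleftrightarrow>
      inv\<^bsub>abel G\<^esub> abel_proj G x \<otimes>\<^bsub>abel G\<^esub> abel_proj G y = \<one>\<^bsub>abel G\<^esub>"
    using abel_proj_eq_one_iff[of "inv x \<otimes> y"] assms by simp
  also have "\<dots> \<longleftrightarrow> abel_proj G x = abel_proj G y"
    using assms p.H.inv_solve_left'[of "\<one>\<^bsub>abel G\<^esub>" "abel_proj G x" "abel_proj G y"]
    by (simp add: eq_commute)
  finally show ?thesis by simp
qed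

end

lemma nil2_groupI: "nil2 G \<Longrightarrow> nil2_group G"
  by (simp add: nil2_group_def nil2_group_axioms_def nil2_def)

text \<open>A homomorphism maps derived subgroup into derived subgroup, so commutators of weight
  three die in \<open>H\<close>, and injectivity reflects this to \<open>L\<close>. It serves both
  for subgroups and for isomorphic copies.\<close>

lemma nil2_if_inj:
  fixes L :: "'b monoid" and H :: "'a monoid"
  assumes L: "group L" and H: "nil2 H" and i: "i \<in> hom L H" and inj: "inj_on i (carrier L)"
  shows "nil2 L"
proof -
  interpret H: nil2_group H using H by (rule nil2_groupI)
  interpret i: group_hom L H i
    using L i H.is_group by (simp add: group_hom_def group_hom_axioms_def)
  have "comm L x g = \<one>\<^bsub>L\<^esub>" if x: "x \<in> derived L (carrier L)" and g: "g \<in> carrier L" for x g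
  proof -
    have x': "x \<in> carrier L" using x i.derived_in_carrier by blast
    have "i x \<in> derived H (i ` carrier L)"
      using i.derived_img[of "carrier L"] x by simp
    also have "\<dots> \<subseteq> derived H (carrier H)"
      by (rule H.mono_derived) auto
    finally have "comm H (i x) (i g) = \<one>\<^bsub>H\<^esub>"
      using H g by (simp add: nil2_def)
    then have "i (comm L x g) = i \<one>\<^bsub>L\<^esub>"
      using x' g by (simp add: comm_def)
    then show ?thesis
      using inj x' g by (auto simp: comm_def inj_on_def)
  qed
  then show ?thesis using L by (simp add: nil2_def)
qed

lemma nil2_if_comm_group:
  assumes "comm_group A"
  shows "nil2 A"
proof -
  interpret comm_group A by fact
  show ?thesis
    using derived_eq_singleton[of "carrier A"] is_group by (simp add: nil2_def comm_def)
qed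

section \<open>Free objects\<close>

text \<open>Transport of structure along an injection \<open>e\<close>. The copy is again of class
  two because the inverse bijection embeds it into \<open>H\<close>.\<close>

lemma image_group_embedding:
  fixes H :: "'c monoid" and e :: "'c \<Rightarrow> 'd"
  assumes H: "nil2 H" and e: "inj_on e (carrier H)"
  shows "nil2 (image_group e H)" "e \<in> hom H (image_group e H)"
    "inv_into (carrier H) e \<in> hom (image_group e H) H"
proof -
  interpret H: group H using H by (simp add: nil2_def)
  have iso: "e \<in> iso H (image_group e H)"
    using inj_imp_image_group_iso[OF e] .
  then have inv_iso: "inv_into (carrier H) e \<in> iso (image_group e H) H"
    by (rule H.iso_set_sym)
  show "e \<in> hom H (image_group e H)" "inv_into (carrier H) e \<in> hom (image_group e H) H"
    using iso inv_iso by (auto simp: iso_def)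
  then show "nil2 (image_group e H)"
    using nil2_if_inj[OF H.inj_imp_image_group_is_group[OF e] H] inv_iso
    by (auto simp: iso_def bij_betw_def)
qed

text \<open>The universal property only tests groups of signed words. An injection \<open>e\<close>
  into that type turns \<open>H\<close> into a test group; the extension is found there and carried
  back along the inverse of \<open>e\<close>.\<close>

lemma free_nil2_on_ex_hom:
  fixes F :: "'k monoid" and H :: "'c monoid" and e :: "'c \<Rightarrow> ('k \<times> bool) list"
  assumes F: "free_nil2_on X F" and H: "nil2 H" and e: "inj_on e (carrier H)"
    and f: "f \<in> X \<rightarrow> carrier H"
  obtains h where "h \<in> hom F H" "\<And>x. x \<in> X \<Longrightarrow> h x = f x"
proof -
  note emb = image_group_embedding[OF H e]
  have "e \<circ> f \<in> X \<rightarrow> carrier (image_group e H)"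
    using f by (auto simp: image_group_def)
  then obtain k where k: "k \<in> hom F (image_group e H)" "\<And>x. x \<in> X \<Longrightarrow> k x = e (f x)"
    using F emb(1) unfolding free_nil2_on_def by (metis comp_apply)
  show thesis
  proof
    show "inv_into (carrier H) e \<circ> k \<in> hom F H"
      using Group.hom_compose[OF k(1) emb(3)] .
    show "(inv_into (carrier H) e \<circ> k) x = f x" if "x \<in> X" for x
      using that k(2) f e by (auto simp: Pi_def)
  qed
qed

lemma free_nil2_on_hom_unique:
  fixes F :: "'k monoid" and H :: "'c monoid" and e :: "'c \<Rightarrow> ('k \<times> bool) list"
  assumes F: "free_nil2_on X F" and H: "nil2 H" and e: "inj_on e (carrier H)"
    and u: "u \<in> hom F H" and v: "v \<in> hom F H" and eq: "\<And>x. x \<in> X \<Longrightarrow> u x = v x"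
    and "group F" and y: "y \<in> carrier F"
  shows "u y = v y"
proof -
  interpret group F by fact
  note emb = image_group_embedding[OF H e]
  have XF: "X \<subseteq> carrier F" using F by (simp add: free_nil2_on_def)
  \<comment> \<open>Uniqueness in \<open>free_nil2_on\<close> is among extensional maps, so both
    homomorphisms are restricted to \<open>carrier F\<close> before being compared.\<close>
  have ex: "(\<lambda>y\<in>carrier F. e (w y)) \<in> hom F (image_group e H) \<inter> extensional (carrier F)"
    if "w \<in> hom F H" for w
    using that emb(2) by (auto simp: hom_def Pi_def)
  have "e \<circ> u \<in> X \<rightarrow> carrier (image_group e H)"
    using u XF by (auto simp: image_group_def hom_def Pi_def)
  then have "\<exists>!h. h \<in> hom F (image_group e H) \<and> h \<in> extensional (carrier F) \<and>
      (\<forall>x\<in>X. h x = (e \<circ> u) x)" (is "\<exists>!h. ?P h")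
    using F emb(1) unfolding free_nil2_on_def by blast
  moreover have "?P (\<lambda>y\<in>carrier F. e (u y))"
    using ex[OF u] XF by auto
  moreover have "?P (\<lambda>y\<in>carrier F. e (v y))"
    using ex[OF v] XF eq by auto
  ultimately have "(\<lambda>y\<in>carrier F. e (u y)) = (\<lambda>y\<in>carrier F. e (v y))"
    by (metis (no_types, lifting))
  then have "e (u y) = e (v y)"
    using y by (auto dest: fun_cong[of _ _ y])
  then show ?thesis
    using e u v y by (auto simp: inj_on_def hom_def Pi_def)
qed

text \<open>Extend the inclusion of \<open>X\<close> to a homomorphism \<open>h\<close> from
  \<open>F\<close> to the subgroup generated by \<open>X\<close>. Seen as an endomorphism of
  \<open>F\<close>, \<open>h\<close> agrees with the identity on \<open>X\<close>, hence everywhere,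
  so each element already lies in that subgroup.\<close>

lemma free_nil2_on_generate:
  fixes F :: "'k monoid"
  assumes nil2: "nil2 F" and F: "free_nil2_on X F"
  shows "generate F X = carrier F"
proof -
  interpret group F using nil2 by (simp add: nil2_def)
  have XF: "X \<subseteq> carrier F" using F by (simp add: free_nil2_on_def)
  let ?L = "F\<lparr>carrier := generate F X\<rparr>"
  \<comment> \<open>One-letter words place the element type of \<open>F\<close> inside the type of
    the test groups, for \<open>F\<close> and its subgroup alike.\<close>
  let ?e = "\<lambda>x. [(x, True)]"
  have sub: "subgroup (generate F X) F"
    using generate_is_subgroup[OF XF] .
  have incl: "(\<lambda>x. x) \<in> hom ?L F"
    using subgroup.subset[OF sub] by (auto simp: hom_def)
  have L: "nil2 ?L"
    by (rule nil2_if_inj[OF subgroup_imp_group[OF sub] nil2 incl]) simp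
  have e: "inj_on ?e A" for A
    by (simp add: inj_on_def)
  obtain h where h: "h \<in> hom F ?L" "\<And>x. x \<in> X \<Longrightarrow> h x = x"
    by (rule free_nil2_on_ex_hom[OF F L e, of "\<lambda>x. x"]) (auto intro: generate.incl)
  have h': "h \<in> hom F F"
    using Group.hom_compose[OF h(1) incl] by (simp add: comp_def)
  have "h y = y" if "y \<in> carrier F" for y
    using free_nil2_on_hom_unique[OF F nil2 e h', of "\<lambda>x. x"] h(2) that is_group
    by (auto simp: hom_def)
  then have "carrier F \<subseteq> generate F X"
    using h(1) by (force simp: hom_def)
  then show ?thesis
    using generate_incl[OF XF] by blast
qed

text \<open>Choosing, for every element of the subgroup generated by \<open>f ` X\<close>, a signed word with that value
  embeds the subgroup into the type of the test groups in \<^const>\<open>free_nil2_on\<close>.\<close>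

primrec word_value :: "('c, 'm) monoid_scheme \<Rightarrow> ('k \<Rightarrow> 'c) \<Rightarrow> ('k \<times> bool) list \<Rightarrow> 'c" where
  "word_value H f [] = \<one>\<^bsub>H\<^esub>"
| "word_value H f (p # w) =
     (if snd p then f (fst p) else inv\<^bsub>H\<^esub> f (fst p)) \<otimes>\<^bsub>H\<^esub> word_value H f w"

lemma (in group) word_value_append:
  assumes "f \<in> UNIV \<rightarrow> carrier G"
  shows "word_value G f v \<in> carrier G"
    "word_value G f (v @ w) = word_value G f v \<otimes> word_value G f w"
proof -
  have cl: "word_value G f u \<in> carrier G" for u
    using assms by (induction u) (auto simp: Pi_def)
  then show "word_value G f v \<in> carrier G" .
  show "word_value G f (v @ w) = word_value G f v \<otimes> word_value G f w"
    using assms by (induction v) (auto simp: Pi_def m_assoc cl)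
qed

text \<open>The empty word, one-letter words and concatenation match the introduction rules of
  \<open>generate\<close>. So evaluation maps onto the generated subgroup, and a right inverse of it
  can be chosen.\<close>

lemma (in group) generate_word_value:
  assumes f: "f \<in> UNIV \<rightarrow> carrier G" and y: "y \<in> generate G (f ` X)"
  shows "\<exists>w. word_value G f w = y"
  using y
proof induction
  case one
  show ?case by (rule exI[of _ "[]"]) simp
next
  case (incl h)
  then obtain x where "h = f x" by auto
  then show ?case using f by (intro exI[of _ "[(x, True)]"]) (auto simp: Pi_def)
next
  case (inv h)
  then obtain x where "h = f x" by auto
  then show ?case using f by (intro exI[of _ "[(x, False)]"]) (auto simp: Pi_def)
next
  case (eng h1 h2)
  then show ?case using word_value_append(2)[OF f] by metis
qed

text \<open>This frees the target from the type of the test groups: only the subgroup generated by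
  the image of \<open>X\<close> matters, and it embeds into signed words.\<close>

theorem free_nil2_on_extend:
  fixes F :: "'k monoid" and H :: "'c monoid"
  assumes F: "free_nil2_on X F" and H: "nil2 H" and f: "f \<in> X \<rightarrow> carrier H"
  obtains h where "h \<in> hom F H" "\<And>x. x \<in> X \<Longrightarrow> h x = f x"
proof -
  interpret H: group H using H by (simp add: nil2_def)
  \<comment> \<open>Words may contain letters outside \<open>X\<close>; the default
    \<open>\<one>\<close> there gives every word a value in \<open>H\<close> and leaves the image of
    \<open>X\<close> unchanged.\<close>
  define f' where "f' x = (if x \<in> X then f x else \<one>\<^bsub>H\<^esub>)" for x
  have f': "f' \<in> UNIV \<rightarrow> carrier H" using f by (auto simp: f'_def)
  then have sub: "subgroup (generate H (f' ` X)) H"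
    by (intro H.generate_is_subgroup) auto
  let ?L = "H\<lparr>carrier := generate H (f' ` X)\<rparr>"
  have incl: "(\<lambda>x. x) \<in> hom ?L H"
    using subgroup.subset[OF sub] by (auto simp: hom_def)
  have L: "nil2 ?L"
    by (rule nil2_if_inj[OF H.subgroup_imp_group[OF sub] H incl]) simp
  obtain e where e: "\<And>y. y \<in> generate H (f' ` X) \<Longrightarrow> word_value H f' (e y) = y"
    using H.generate_word_value[OF f'] by metis
  \<comment> \<open>A choice of words is injective because evaluation is a left inverse.\<close>
  then have "inj_on e (carrier ?L)"
    by (intro inj_on_inverseI[of _ "word_value H f'"]) simp
  then obtain h where h: "h \<in> hom F ?L" "\<And>x. x \<in> X \<Longrightarrow> h x = f' x"
    by (rule free_nil2_on_ex_hom[OF F L, of e f']) (auto intro: generate.incl)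
  show thesis
  proof
    show "h \<in> hom F H"
      using Group.hom_compose[OF h(1) incl] by (simp add: comp_def)
    show "h x = f x" if "x \<in> X" for x
      using h(2) that by (simp add: f'_def)
  qed
qed

lemma group_hom_eq_on_generate:
  assumes "group_hom F H u" and "group_hom F H v" and X: "X \<subseteq> carrier F"
    and eq: "\<And>x. x \<in> X \<Longrightarrow> u x = v x" and y: "y \<in> generate F X"
  shows "u y = v y"
proof -
  interpret u: group_hom F H u by fact
  interpret v: group_hom F H v by fact
  show ?thesis
    using y
  proof induction
    case (eng h1 h2)
    then show ?case using u.G.generate_in_carrier[OF X] by simp
  qed (use X eq in auto)
qed

text \<open>Free groups are projective for surjections: choose preimages of the \<open>q x\<close>
  for generators \<open>x\<close> and extend. The maps \<open>p \<circ> h\<close> and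
  \<open>q\<close> are compared on the generating set \<open>X\<close>, since the universal property
  concerns only targets of class two.\<close>

proposition free_nil2_lift:
  fixes F :: "'k monoid" and H :: "'c monoid"
  assumes F: "free_nil2 F" and H: "nil2 H" and P: "group P"
    and p: "p \<in> hom H P" "p ` carrier H = carrier P" and q: "q \<in> hom F P"
  obtains h where "h \<in> hom F H" "\<And>x. x \<in> carrier F \<Longrightarrow> p (h x) = q x"
proof -
  obtain X where nil2: "nil2 F" and X: "free_nil2_on X F"
    using F by (auto simp: free_nil2_def)
  have XF: "X \<subseteq> carrier F" using X by (simp add: free_nil2_on_def)
  have "\<forall>x\<in>X. \<exists>y. y \<in> carrier H \<and> p y = q x"
  proof
    fix x assume "x \<in> X"
    then have "q x \<in> p ` carrier H" using q p(2) XF by (auto simp: hom_def)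
    then show "\<exists>y. y \<in> carrier H \<and> p y = q x" by auto
  qed
  then have "\<exists>f. \<forall>x\<in>X. f x \<in> carrier H \<and> p (f x) = q x"
    by (rule bchoice)
  then obtain f where f: "f \<in> X \<rightarrow> carrier H" "\<And>x. x \<in> X \<Longrightarrow> p (f x) = q x"
    by blast
  obtain h where h: "h \<in> hom F H" "\<And>x. x \<in> X \<Longrightarrow> h x = f x"
    using free_nil2_on_extend[OF X H f(1)] by blast
  have "group F" using nil2 by (simp add: nil2_def)
  then have *: "group_hom F P (p \<circ> h)" "group_hom F P q"
    using Group.hom_compose[OF h(1) p(1)] q P by (simp_all add: group_hom_def group_hom_axioms_def)
  have "(p \<circ> h) x = q x" if "x \<in> carrier F" for x
    using group_hom_eq_on_generate[OF * XF] h(2) f(2) that free_nil2_on_generate[OF nil2 X] by simp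
  then show thesis using that h(1) by simp
qed

section \<open>q-maps\<close>

lemma (in group) mult_inv_cancel:
  assumes "a \<in> carrier G" "b \<in> carrier G" "c \<in> carrier G"
  shows "(inv a \<otimes> b) \<otimes> (inv b \<otimes> c) = inv a \<otimes> c"
proof -
  have "b \<otimes> (inv b \<otimes> c) = c" using assms by (simp add: m_assoc[symmetric])
  then show ?thesis using assms by (simp add: m_assoc)
qed

section \<open>Bilinear cross effects with values in the commutator subgroup\<close>

context nil2_group
begin

text \<open>Stated for an arbitrary \<open>c\<close>, so that products and inverses of cross effects
  can be treated apart from the maps that they come from.\<close>

definition bilinear_on :: "'b monoid \<Rightarrow> ('b \<Rightarrow> 'b \<Rightarrow> 'a) \<Rightarrow> bool" where
  "bilinear_on K c \<longleftrightarrow>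
     (\<forall>x\<in>carrier K. \<forall>y\<in>carrier K. c x y \<in> D) \<and>
     (\<forall>x\<in>carrier K. \<forall>y\<in>carrier K. \<forall>z\<in>carrier K.
        c (x \<otimes>\<^bsub>K\<^esub> y) z = c x z \<otimes> c y z \<and> c x (y \<otimes>\<^bsub>K\<^esub> z) = c x y \<otimes> c x z)"

lemma bilinear_on_cong:
  assumes "bilinear_on K c" "monoid K"
    and "\<And>x y. x \<in> carrier K \<Longrightarrow> y \<in> carrier K \<Longrightarrow> c' x y = c x y"
  shows "bilinear_on K c'"
  using assms monoid.m_closed[OF assms(2)] by (simp add: bilinear_on_def)

lemma bilinear_on_mult:
  assumes "bilinear_on K c" "bilinear_on K c'"
  shows "bilinear_on K (\<lambda>x y. c x y \<otimes> c' x y)"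
  using assms by (simp add: bilinear_on_def m_assoc derived_lcomm)

lemma bilinear_on_inv:
  assumes "bilinear_on K c"
  shows "bilinear_on K (\<lambda>x y. inv (c x y))"
  using assms by (simp add: bilinear_on_def inv_mult_group derived_central)

text \<open>Elements of \<open>D\<close> are central, so the requirement that cross effects commute
  with values of \<open>f\<close> holds as soon as they lie in \<open>D\<close>.\<close>

lemma q_map_iff:
  "q_map K G f \<longleftrightarrow> nil2 K \<and> f \<in> carrier K \<rightarrow> carrier G \<and> bilinear_on K (cross K G f)"
  using nil2 unfolding q_map_def weakly_quadratic_def bilinear_on_def
  by (auto simp: Pi_def derived_central)

lemma q_map_closed: "q_map K G f \<Longrightarrow> x \<in> carrier K \<Longrightarrow> f x \<in> carrier G"
  by (auto simp: q_map_iff)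

lemma q_map_cong:
  assumes f: "q_map K G f" and eq: "\<And>x. x \<in> carrier K \<Longrightarrow> f' x = f x"
  shows "q_map K G f'"
proof -
  have K: "monoid K" using f by (simp add: q_map_iff nil2_def group.is_monoid)
  have "bilinear_on K (cross K G f)" using f by (simp add: q_map_iff)
  then have "bilinear_on K (cross K G f')"
    by (rule bilinear_on_cong[OF _ K]) (simp add: cross_def eq monoid.m_closed[OF K])
  then show ?thesis using f eq by (auto simp: q_map_iff Pi_def)
qed

lemma q_map_imp_quadratic: "q_map K G f \<Longrightarrow> quadratic K G f"
  by (simp add: quadratic_def q_map_def derived_central)

text \<open>Inverses in the subgroup are those of \<open>G\<close>, so both readings of the cross
  effect coincide. Cochains with coefficients in the commutator subgroup can thus be handled as
  \<open>D\<close>-valued q-maps into \<open>G\<close>.\<close>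

lemma quadratic_derived_group_iff:
  assumes "nil2 K"
  shows "quadratic K (derived_group G) f \<longleftrightarrow> q_map K G f \<and> f \<in> carrier K \<rightarrow> D"
proof (cases "f \<in> carrier K \<rightarrow> D")
  case True
  interpret K: group K using assms by (simp add: nil2_def)
  have "inv\<^bsub>derived_group G\<^esub> x = inv x" if "x \<in> D" for x
    unfolding derived_group_def using m_inv_consistent[OF derived_subgroup that] .
  then have cross: "cross K (derived_group G) f x y = cross K G f x y \<and> cross K G f x y \<in> D"
    if "x \<in> carrier K" "y \<in> carrier K" for x y
    using True that by (simp add: cross_def derived_group_def Pi_def)
  have Df: "f \<in> carrier K \<rightarrow> carrier (derived_group G)" "f \<in> carrier K \<rightarrow> carrier G"
    using True by (auto simp: derived_group_def Pi_def)
  show ?thesis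
    using True Df assms cross
    unfolding quadratic_def weakly_quadratic_def q_map_iff bilinear_on_def
    by (auto simp: derived_group_def Pi_def derived_central)
qed (auto simp: quadratic_def weakly_quadratic_def derived_group_def)

section \<open>Cancellation laws with central factors\<close>

lemma inv_mult_central:
  assumes "u \<in> carrier G" "v \<in> carrier G" "w \<in> D" "t \<in> D"
  shows "inv (u \<otimes> w) \<otimes> (v \<otimes> t) = (inv u \<otimes> v) \<otimes> (inv w \<otimes> t)"
proof -
  have "inv (u \<otimes> w) \<otimes> (v \<otimes> t) = inv w \<otimes> ((inv u \<otimes> v) \<otimes> t)"
    using assms by (simp add: inv_mult_group m_assoc)
  also have "\<dots> = (inv u \<otimes> v) \<otimes> (inv w \<otimes> t)"
    using assms by (intro derived_lcomm[symmetric]) simp_all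
  finally show ?thesis .
qed

text \<open>The pointwise content of \<open>lift_diff_twist\<close>: \<open>u\<close>,
  \<open>v\<close> stand for the values of a lift at the faces \<open>d0\<close>, \<open>d1\<close>,
  and \<open>w\<close>, \<open>t\<close> for those of a cochain.\<close>

lemma twist_cancel:
  assumes "u \<in> carrier G" "v \<in> carrier G" "w \<in> D" "t \<in> D"
  shows "(w \<otimes> inv t) \<otimes> (inv (u \<otimes> w) \<otimes> (v \<otimes> t)) = inv u \<otimes> v"
proof -
  have "w \<otimes> inv t \<otimes> (inv w \<otimes> t) = \<one>"
    using assms mult_inv_cancel[of t w t] derived_central[of w "inv t"] by simp
  moreover have "(w \<otimes> inv t) \<otimes> ((inv u \<otimes> v) \<otimes> (inv w \<otimes> t)) =
      (inv u \<otimes> v) \<otimes> ((w \<otimes> inv t) \<otimes> (inv w \<otimes> t))"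
    using assms by (intro derived_lcomm[symmetric]) simp_all
  ultimately show ?thesis
    using assms by (simp only: inv_mult_central) simp
qed

text \<open>The pointwise cocycle condition, with \<open>a\<close>, \<open>b\<close>,
  \<open>c\<close> the values of a lift at the three vertices of a 2-simplex. Once the central
  factor \<open>inv a \<otimes> b\<close> is moved past the middle term, the product
  telescopes.\<close>

lemma triple_cancel:
  assumes "a \<in> carrier G" "b \<in> carrier G" "c \<in> carrier G" and "inv a \<otimes> b \<in> D"
  shows "(inv a \<otimes> b) \<otimes> inv (inv a \<otimes> c) \<otimes> (inv b \<otimes> c) = \<one>"
proof -
  have "(inv a \<otimes> b) \<otimes> inv (inv a \<otimes> c) \<otimes> (inv b \<otimes> c) =
      inv (inv a \<otimes> c) \<otimes> ((inv a \<otimes> b) \<otimes> (inv b \<otimes> c))"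
    using assms derived_central[of "inv a \<otimes> b" "inv (inv a \<otimes> c)"]
      m_assoc[of "inv (inv a \<otimes> c)" "inv a \<otimes> b" "inv b \<otimes> c"] by simp
  then show ?thesis
    using assms by (simp add: mult_inv_cancel)
qed

text \<open>As \<open>z\<close> has central values, the factors from \<open>f\<close> and those from
  \<open>z\<close> separate.\<close>

lemma cross_mult:
  assumes K: "monoid K" and f: "f \<in> carrier K \<rightarrow> carrier G" and z: "z \<in> carrier K \<rightarrow> D"
    and xy: "x \<in> carrier K" "y \<in> carrier K"
  shows "cross K G (\<lambda>x. f x \<otimes> z x) x y = cross K G f x y \<otimes> cross K G z x y"
proof -
  have cl: "f x \<in> carrier G" "f y \<in> carrier G" "z x \<in> D" "z y \<in> D"
    "f (x \<otimes>\<^bsub>K\<^esub> y) \<in> carrier G" "z (x \<otimes>\<^bsub>K\<^esub> y) \<in> D"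
    using f z xy monoid.m_closed[OF K] by (auto simp: Pi_def)
  then have "(f x \<otimes> z x) \<otimes> (f y \<otimes> z y) = (f x \<otimes> f y) \<otimes> (z x \<otimes> z y)"
    by (simp add: m_assoc derived_lcomm[of "z x" "f y"])
  then show ?thesis
    using cl by (simp add: cross_def inv_mult_central)
qed

lemma q_map_mult:
  assumes f: "q_map K G f" and z: "q_map K G z" "z \<in> carrier K \<rightarrow> D"
  shows "q_map K G (\<lambda>x. f x \<otimes> z x)"
proof -
  have K: "monoid K" using f by (simp add: q_map_iff nil2_def group.is_monoid)
  have "bilinear_on K (\<lambda>x y. cross K G f x y \<otimes> cross K G z x y)"
    by (rule bilinear_on_mult) (use f z in \<open>simp_all add: q_map_iff\<close>)
  then have "bilinear_on K (cross K G (\<lambda>x. f x \<otimes> z x))"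
    by (rule bilinear_on_cong[OF _ K]) (use cross_mult[OF K _ z(2)] f in \<open>simp add: q_map_iff\<close>)
  then show ?thesis using f z by (auto simp: q_map_iff Pi_def)
qed

text \<open>The quotient \<open>?z\<close> satisfies \<open>f x \<otimes> ?z x = f' x\<close> and is
  \<open>D\<close>-valued, so \<open>cross_mult\<close> can be solved for its cross effect, a
  product of bilinear maps.\<close>

lemma q_map_divide:
  assumes f: "q_map K G f" and f': "q_map K G f'"
    and D: "\<And>x. x \<in> carrier K \<Longrightarrow> inv (f x) \<otimes> f' x \<in> D"
  shows "q_map K G (\<lambda>x. inv (f x) \<otimes> f' x)"
proof -
  let ?z = "\<lambda>x. inv (f x) \<otimes> f' x"
  have K: "monoid K" using f by (simp add: q_map_iff nil2_def group.is_monoid)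
  have z: "?z \<in> carrier K \<rightarrow> D" using D by simp
  have ff': "f x \<otimes> ?z x = f' x" if "x \<in> carrier K" for x
    using that q_map_closed[OF f] q_map_closed[OF f'] by (simp add: m_assoc[symmetric])
  have eq: "cross K G ?z x y = inv (cross K G f x y) \<otimes> cross K G f' x y"
    if xy: "x \<in> carrier K" "y \<in> carrier K" for x y
  proof -
    have "cross K G f x y \<otimes> cross K G ?z x y = cross K G (\<lambda>x. f x \<otimes> ?z x) x y"
      using cross_mult[OF K _ z xy, of f] f by (simp add: q_map_iff)
    also have "\<dots> = cross K G f' x y"
      using xy monoid.m_closed[OF K] by (simp add: cross_def ff')
    finally have "cross K G f' x y = cross K G f x y \<otimes> cross K G ?z x y" ..
    moreover have "cross K G f x y \<in> carrier G" "cross K G ?z x y \<in> carrier G"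
      using xy z monoid.m_closed[OF K] q_map_closed[OF f] q_map_closed[OF f']
      by (auto simp: cross_def)
    ultimately show ?thesis by (simp add: m_assoc[symmetric])
  qed
  have "bilinear_on K (\<lambda>x y. inv (cross K G f x y) \<otimes> cross K G f' x y)"
    by (rule bilinear_on_mult[OF bilinear_on_inv]) (use f f' in \<open>simp_all add: q_map_iff\<close>)
  then have "bilinear_on K (cross K G ?z)"
    by (rule bilinear_on_cong[OF _ K]) (rule eq)
  then show ?thesis using f z by (auto simp: q_map_iff Pi_def)
qed

lemma q_map_one: "nil2 K \<Longrightarrow> q_map K G (\<lambda>_. \<one>)"
  by (simp add: q_map_iff bilinear_on_def cross_def)

lemma q_map_inv:
  assumes "q_map K G z" "z \<in> carrier K \<rightarrow> D"
  shows "q_map K G (\<lambda>x. inv (z x))"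
proof -
  have "q_map K G (\<lambda>x. inv (z x) \<otimes> \<one>)"
    using assms q_map_one[of K] by (intro q_map_divide) (auto simp: q_map_iff Pi_def)
  then show ?thesis
    by (rule q_map_cong) (simp add: q_map_closed[OF assms(1)])
qed

lemma q_map_comp:
  assumes f: "q_map L G f" and K: "nil2 K" and h: "h \<in> hom K L"
  shows "q_map K G (\<lambda>x. f (h x))"
proof -
  have hm: "h (x \<otimes>\<^bsub>K\<^esub> y) = h x \<otimes>\<^bsub>L\<^esub> h y" "h x \<in> carrier L"
    if "x \<in> carrier K" "y \<in> carrier K" for x y
    using h that by (auto simp: hom_def)
  have eq: "cross K G (\<lambda>x. f (h x)) x y = cross L G f (h x) (h y)"
    if "x \<in> carrier K" "y \<in> carrier K" for x y
    using that by (simp add: cross_def hm)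
  have M: "monoid K" using K by (simp add: nil2_def group.is_monoid)
  have "bilinear_on K (\<lambda>x y. cross L G f (h x) (h y))"
    using f hm by (simp add: q_map_iff bilinear_on_def)
  then have "bilinear_on K (cross K G (\<lambda>x. f (h x)))"
    by (rule bilinear_on_cong[OF _ M]) (rule eq)
  then show ?thesis using f K hm by (auto simp: q_map_iff Pi_def)
qed

lemma q_map_hom:
  assumes "nil2 K" and "h \<in> hom K G"
  shows "q_map K G h"
proof -
  have eq: "cross K G h x y = \<one>" if "x \<in> carrier K" "y \<in> carrier K" for x y
  proof -
    have "h x \<otimes> h y \<in> carrier G" using assms that by (auto simp: hom_def Pi_def)
    then show ?thesis using assms that by (simp add: cross_def hom_def)
  qed
  have M: "monoid K" using assms by (simp add: nil2_def group.is_monoid)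
  have "bilinear_on K (\<lambda>_ _. \<one>)" by (simp add: bilinear_on_def)
  then have "bilinear_on K (cross K G h)"
    by (rule bilinear_on_cong[OF _ M]) (rule eq)
  then show ?thesis using assms by (auto simp: q_map_iff hom_def)
qed

section \<open>The abelian group of quadratic maps into the commutator subgroup\<close>

abbreviation Quad where "Quad K \<equiv> quad_group K (derived_group G)"

lemma carrier_Quad:
  assumes "nil2 K"
  shows "f \<in> carrier (Quad K) \<longleftrightarrow> f \<in> extensional (carrier K) \<and> q_map K G f \<and> f \<in> carrier K \<rightarrow> D"
  using assms by (simp add: quad_group_def quadratic_derived_group_iff)

lemma restrict_in_Quad:
  assumes "q_map K G f" "f \<in> carrier K \<rightarrow> D"
  shows "(\<lambda>x\<in>carrier K. f x) \<in> carrier (Quad K)"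
proof -
  have "nil2 K" using assms by (simp add: q_map_iff)
  moreover have "q_map K G (\<lambda>x\<in>carrier K. f x)"
    using assms(1) by (rule q_map_cong) simp
  ultimately show ?thesis
    using assms(2) by (auto simp: carrier_Quad)
qed

lemma mult_Quad: "f \<otimes>\<^bsub>Quad K\<^esub> g = (\<lambda>x\<in>carrier K. f x \<otimes> g x)"
  and one_Quad: "\<one>\<^bsub>Quad K\<^esub> = (\<lambda>x\<in>carrier K. \<one>)"
  by (simp_all add: quad_group_def derived_group_def)

lemma Quad_closed:
  assumes "nil2 K" "f \<in> carrier (Quad K)" "x \<in> carrier K"
  shows "f x \<in> D"
  using assms by (auto simp: carrier_Quad)

lemma inv_restrict_in_Quad:
  assumes "nil2 K" "f \<in> carrier (Quad K)"
  shows "(\<lambda>x\<in>carrier K. inv (f x)) \<in> carrier (Quad K)"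
  using assms by (intro restrict_in_Quad q_map_inv) (auto simp: carrier_Quad Pi_def)

lemma inv_restrict_mult_Quad:
  assumes "nil2 K" "f \<in> carrier (Quad K)"
  shows "(\<lambda>x\<in>carrier K. inv (f x)) \<otimes>\<^bsub>Quad K\<^esub> f = \<one>\<^bsub>Quad K\<^esub>"
  using Quad_closed[OF assms] by (auto simp: mult_Quad one_Quad intro!: restrict_ext)

lemma comm_group_Quad:
  assumes K: "nil2 K"
  shows "comm_group (Quad K)"
proof (rule comm_groupI)
  interpret K: group K using K by (simp add: nil2_def)
  note cl = Quad_closed[OF K]
  show "\<one>\<^bsub>Quad K\<^esub> \<in> carrier (Quad K)"
    unfolding one_Quad by (rule restrict_in_Quad) (simp_all add: q_map_one[OF K])
  fix f g assume f: "f \<in> carrier (Quad K)" and g: "g \<in> carrier (Quad K)"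
  show "f \<otimes>\<^bsub>Quad K\<^esub> g \<in> carrier (Quad K)"
    unfolding mult_Quad using f g K
    by (intro restrict_in_Quad q_map_mult) (auto simp: carrier_Quad Pi_def)
  show "f \<otimes>\<^bsub>Quad K\<^esub> g = g \<otimes>\<^bsub>Quad K\<^esub> f"
    using cl[OF f] cl[OF g] by (auto simp: mult_Quad derived_central intro!: restrict_ext)
  show "(f \<otimes>\<^bsub>Quad K\<^esub> g) \<otimes>\<^bsub>Quad K\<^esub> h = f \<otimes>\<^bsub>Quad K\<^esub> (g \<otimes>\<^bsub>Quad K\<^esub> h)"
    if h: "h \<in> carrier (Quad K)" for h
    using cl[OF f] cl[OF g] cl[OF h] by (auto simp: mult_Quad m_assoc intro!: restrict_ext)
  show "\<one>\<^bsub>Quad K\<^esub> \<otimes>\<^bsub>Quad K\<^esub> f = f"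
    using f K cl[OF f]
    by (auto simp: mult_Quad one_Quad carrier_Quad intro!: extensionalityI[of _ "carrier K"])
  show "\<exists>g\<in>carrier (Quad K). g \<otimes>\<^bsub>Quad K\<^esub> f = \<one>\<^bsub>Quad K\<^esub>"
    using inv_restrict_in_Quad[OF K f] inv_restrict_mult_Quad[OF K f] by blast
qed

lemma inv_Quad:
  assumes K: "nil2 K" and f: "f \<in> carrier (Quad K)"
  shows "inv\<^bsub>Quad K\<^esub> f = (\<lambda>x\<in>carrier K. inv (f x))"
proof -
  interpret Q: comm_group "Quad K" using comm_group_Quad[OF K] .
  show ?thesis
    using Q.inv_equality[OF inv_restrict_mult_Quad[OF K f] f inv_restrict_in_Quad[OF K f]] .
qed

lemma Quad_comp:
  assumes K: "nil2 K" and L: "nil2 L" and h: "h \<in> hom K L" and f: "f \<in> carrier (Quad L)"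
  shows "(\<lambda>x\<in>carrier K. f (h x)) \<in> carrier (Quad K)"
  using f h L by (intro restrict_in_Quad q_map_comp[OF _ K h]) (auto simp: carrier_Quad hom_def)

end

section \<open>Simplicial identities\<close>

lemma simplicial_nil2D:
  assumes "simplicial_nil2 S"
  shows "nil2 (grp S n)"
    and "i \<le> Suc n \<Longrightarrow> face S n i \<in> hom (grp S (Suc n)) (grp S n)"
    and "i \<le> n \<Longrightarrow> degen S n i \<in> hom (grp S n) (grp S (Suc n))"
    and "j \<le> Suc (Suc n) \<Longrightarrow> i < j \<Longrightarrow> x \<in> carrier (grp S (Suc (Suc n))) \<Longrightarrow>
        face S n i (face S (Suc n) j x) = face S n (j - 1) (face S (Suc n) i x)"
    and "j \<le> n \<Longrightarrow> x \<in> carrier (grp S n) \<Longrightarrow> face S n j (degen S n j x) = x"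
    and "j \<le> n \<Longrightarrow> x \<in> carrier (grp S n) \<Longrightarrow> face S n (Suc j) (degen S n j x) = x"
proof -
  note * = assms[unfolded simplicial_nil2_def]
  show "nil2 (grp S n)"
    using *[THEN conjunct1] by blast
  show "i \<le> Suc n \<Longrightarrow> face S n i \<in> hom (grp S (Suc n)) (grp S n)"
    using *[THEN conjunct2, THEN conjunct1] by blast
  show "i \<le> n \<Longrightarrow> degen S n i \<in> hom (grp S n) (grp S (Suc n))"
    using *[THEN conjunct2, THEN conjunct2, THEN conjunct1] by blast
  show "j \<le> Suc (Suc n) \<Longrightarrow> i < j \<Longrightarrow> x \<in> carrier (grp S (Suc (Suc n))) \<Longrightarrow>
      face S n i (face S (Suc n) j x) = face S n (j - 1) (face S (Suc n) i x)"
    using *[THEN conjunct2, THEN conjunct2, THEN conjunct2, THEN conjunct1] by blast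
  have "\<forall>n. \<forall>j\<le>n. \<forall>x\<in>carrier (grp S n).
      face S n j (degen S n j x) = x \<and> face S n (Suc j) (degen S n j x) = x"
    using * by (elim conjE)
  then show "j \<le> n \<Longrightarrow> x \<in> carrier (grp S n) \<Longrightarrow> face S n j (degen S n j x) = x"
    "j \<le> n \<Longrightarrow> x \<in> carrier (grp S n) \<Longrightarrow> face S n (Suc j) (degen S n j x) = x"
    by blast+
qed

section \<open>Cochains in low degrees\<close>

locale simplicial_coefficients = nil2_group G for G :: "'a monoid" (structure) +
  fixes S :: "'k simp_grp"
  assumes simplicial: "simplicial_nil2 S"
begin

abbreviation A where "A \<equiv> derived_group G"

lemmas nil2_S = simplicial_nil2D(1)[OF simplicial]

lemma coface_closed:
  assumes "f \<in> carrier (Quad (grp S n))" "j \<le> Suc n"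
  shows "quad_coface S n j f \<in> carrier (Quad (grp S (Suc n)))"
  unfolding quad_coface_def
  by (rule Quad_comp[OF nil2_S nil2_S simplicial_nil2D(2)[OF simplicial assms(2)] assms(1)])

lemma face_closed: "j \<le> Suc n \<Longrightarrow> x \<in> carrier (grp S (Suc n)) \<Longrightarrow> face S n j x \<in> carrier (grp S n)"
  using simplicial_nil2D(2)[OF simplicial] by (auto simp: hom_def)

text \<open>The sign matters: here \<open>d0\<close> enters positively and \<open>d1\<close>
  negatively, opposite to the convention of \<open>lift_diff\<close>.\<close>

lemma quad_diff_0:
  assumes f: "f \<in> carrier (Quad (grp S 0))"
  shows "quad_diff S A 0 f = (\<lambda>x\<in>carrier (grp S 1). f (face S 0 0 x) \<otimes> inv (f (face S 0 1 x)))"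
proof -
  interpret Q: comm_group "Quad (grp S (Suc 0))" using comm_group_Quad[OF nil2_S] .
  note cl = coface_closed[OF f]
  have d: "f (face S 0 j x) \<in> D" if "j \<le> 1" "x \<in> carrier (grp S (Suc 0))" for j x
    using Quad_closed[OF nil2_S f] face_closed[of j 0 x] that by simp
  have "quad_diff S A 0 f = inv\<^bsub>Quad (grp S (Suc 0))\<^esub> quad_coface S 0 1 f
      \<otimes>\<^bsub>Quad (grp S (Suc 0))\<^esub> quad_coface S 0 0 f"
    using cl unfolding quad_diff_def by (simp add: Pi_def Q.int_pow_neg)
  then show ?thesis
    using cl d derived_central
    by (auto simp: inv_Quad[OF nil2_S] mult_Quad quad_coface_def intro!: restrict_ext)
qed

lemma quad_diff_1:
  assumes f: "f \<in> carrier (Quad (grp S 1))"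
  shows "quad_diff S A 1 f = (\<lambda>x\<in>carrier (grp S (Suc 1)).
    f (face S 1 0 x) \<otimes> inv (f (face S 1 1 x)) \<otimes> f (face S 1 (Suc 1) x))"
proof -
  let ?Q = "Quad (grp S (Suc (Suc 0)))"
  interpret Q: comm_group ?Q using comm_group_Quad[OF nil2_S] .
  have cl: "quad_coface S (Suc 0) j f \<in> carrier ?Q" if "j \<le> Suc (Suc 0)" for j
    using coface_closed[of f "Suc 0"] f that by simp
  have d: "f (face S (Suc 0) j x) \<in> D"
    if "j \<le> Suc (Suc 0)" "x \<in> carrier (grp S (Suc (Suc 0)))" for j x
    using Quad_closed[OF nil2_S f] face_closed[of j "Suc 0" x] that by simp
  \<comment> \<open>The finite product unfolds from the largest index down; commutativity afterwards
    restores the order of the faces.\<close>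
  have "quad_diff S A (Suc 0) f = quad_coface S (Suc 0) (Suc (Suc 0)) f \<otimes>\<^bsub>?Q\<^esub>
      (inv\<^bsub>?Q\<^esub> quad_coface S (Suc 0) (Suc 0) f \<otimes>\<^bsub>?Q\<^esub> quad_coface S (Suc 0) 0 f)"
    using cl unfolding quad_diff_def by (simp add: Pi_def Q.int_pow_neg)
  then show ?thesis
    using cl d
    by (auto simp: inv_Quad[OF nil2_S] mult_Quad quad_coface_def m_assoc derived_central
        derived_lcomm intro!: restrict_ext)
qed

text \<open>Needed to see the 1-coboundaries as the image of a homomorphism, hence as a
  subgroup.\<close>

lemma quad_diff_0_hom: "quad_diff S A 0 \<in> hom (Quad (grp S 0)) (Quad (grp S 1))"
proof (rule homI)
  note cl = Quad_closed[OF nil2_S]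
  interpret Q: comm_group "Quad (grp S 0)" using comm_group_Quad[OF nil2_S] .
  interpret Q1: comm_group "Quad (grp S (Suc 0))" using comm_group_Quad[OF nil2_S] .
  show "quad_diff S A 0 f \<in> carrier (Quad (grp S 1))" if "f \<in> carrier (Quad (grp S 0))" for f
    unfolding quad_diff_def
    using coface_closed[OF that] by (auto intro!: Q1.finprod_closed)
  fix f g assume fg: "f \<in> carrier (Quad (grp S 0))" "g \<in> carrier (Quad (grp S 0))"
  have "f (face S 0 j x) \<in> D \<and> g (face S 0 j x) \<in> D" if "j \<le> 1" "x \<in> carrier (grp S 1)" for j x
    using cl[OF fg(1)] cl[OF fg(2)] face_closed[of j 0 x] that by simp
  then show "quad_diff S A 0 (f \<otimes>\<^bsub>Quad (grp S 0)\<^esub> g) =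
      quad_diff S A 0 f \<otimes>\<^bsub>Quad (grp S 1)\<^esub> quad_diff S A 0 g"
    unfolding quad_diff_0[OF fg(1)] quad_diff_0[OF fg(2)] quad_diff_0[OF Q.m_closed[OF fg]]
    using face_closed[of _ 0]
    by (auto simp: mult_Quad m_assoc inv_mult_group derived_lcomm derived_central
        intro!: restrict_ext)
qed

lemma coboundaries_1: "quad_coboundaries S A 1 = quad_diff S A 0 ` carrier (Quad (grp S 0))"
  by (simp add: quad_coboundaries_def)

lemma coboundaries_subgroup: "subgroup (quad_coboundaries S A 1) (Quad (grp S 1))"
proof -
  interpret group_hom "Quad (grp S 0)" "Quad (grp S 1)" "quad_diff S A 0"
    using quad_diff_0_hom comm_group_Quad[OF nil2_S]
    by (simp add: group_hom_def group_hom_axioms_def comm_group_def)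
  show ?thesis unfolding coboundaries_1 by (rule img_is_subgroup)
qed

lemma quad_class_eqI:
  assumes "\<alpha> \<in> carrier (Quad (grp S 0))" "z' \<in> carrier (Quad (grp S 1))"
    and "z = quad_diff S A 0 \<alpha> \<otimes>\<^bsub>Quad (grp S 1)\<^esub> z'"
  shows "quad_class S A 1 z = quad_class S A 1 z'"
proof -
  interpret Q: comm_group "Quad (grp S 1)" using comm_group_Quad[OF nil2_S] .
  have "z \<in> quad_coboundaries S A 1 #>\<^bsub>Quad (grp S 1)\<^esub> z'"
    using assms unfolding coboundaries_1 r_coset_def by blast
  then show ?thesis
    unfolding quad_class_def
    using Q.repr_independence[OF _ assms(2) coboundaries_subgroup] by simp
qed

lemma quad_class_eq_one_iff:
  assumes "z \<in> carrier (Quad (grp S 1))"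
  shows "quad_class S A 1 z = \<one>\<^bsub>quad_coh S A 1\<^esub> \<longleftrightarrow> (\<exists>\<alpha>\<in>carrier (Quad (grp S 0)). z = quad_diff S A 0 \<alpha>)"
proof -
  interpret Q: comm_group "Quad (grp S 1)" using comm_group_Quad[OF nil2_S] .
  show ?thesis
    using Q.coset_join1[OF _ assms coboundaries_subgroup]
      Q.coset_join2[OF assms coboundaries_subgroup]
    unfolding quad_class_def quad_coh_def one_FactGroup coboundaries_1 by blast
qed

end

section \<open>The augmentation\<close>

locale resolution =
  fixes S :: "'k simp_grp" and \<theta> :: "'k set \<Rightarrow> 'c" and K :: "'c monoid"
  assumes resolution: "free_resolution S \<theta> K"
begin

lemma simplicial: "simplicial_nil2 S"
  and free: "free_nil2 (grp S n)"
  and iso: "\<theta> \<in> iso (homotopy_grp S 0) K"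
  using resolution by (simp_all add: free_resolution_def)

abbreviation B where "B \<equiv> moore_boundaries S 0"

lemma group_grp: "group (grp S n)"
  using simplicial_nil2D(1)[OF simplicial] by (simp add: nil2_def)

lemma group_hom_face: "i \<le> Suc n \<Longrightarrow> group_hom (grp S (Suc n)) (grp S n) (face S n i)"
  using group_grp simplicial_nil2D(2)[OF simplicial]
  by (simp add: group_hom_def group_hom_axioms_def)

lemma group_hom_degen: "i \<le> n \<Longrightarrow> group_hom (grp S n) (grp S (Suc n)) (degen S n i)"
  using group_grp simplicial_nil2D(3)[OF simplicial]
  by (simp add: group_hom_def group_hom_axioms_def)

sublocale d0: group_hom "grp S (Suc 0)" "grp S 0" "face S 0 0"
  using group_hom_face[of 0 0] by simp

sublocale d1: group_hom "grp S (Suc 0)" "grp S 0" "face S 0 (Suc 0)"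
  using group_hom_face[of "Suc 0" 0] by simp

sublocale s0: group_hom "grp S 0" "grp S (Suc 0)" "degen S 0 0"
  using group_hom_degen[of 0 0] by simp

lemma d_s0 [simp]:
  "x \<in> carrier (grp S 0) \<Longrightarrow> face S 0 0 (degen S 0 0 x) = x"
  "x \<in> carrier (grp S 0) \<Longrightarrow> face S 0 (Suc 0) (degen S 0 0 x) = x"
  using simplicial_nil2D(5)[OF simplicial, of 0 0] simplicial_nil2D(6)[OF simplicial, of 0 0]
  by simp_all

lemma boundaries_0: "B = face S 0 (Suc 0) ` kernel (grp S (Suc 0)) (grp S 0) (face S 0 0)"
  by (simp add: moore_boundaries_def kernel_def)

text \<open>Since \<open>d1\<close> undoes \<open>s0\<close>, conjugation by \<open>x\<close> in
  degree 0 lifts to conjugation by \<open>s0 x\<close> in degree 1, which preserves the kernel of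
  \<open>d0\<close>.\<close>

lemma boundaries_normal: "B \<lhd> grp S 0"
proof (rule d0.H.normal_invI)
  show "subgroup B (grp S 0)"
    unfolding boundaries_0 by (rule d1.subgroup_img_is_subgroup[OF d0.subgroup_kernel])
  fix x h assume "h \<in> B" and x: "x \<in> carrier (grp S 0)"
  then obtain w where w: "w \<in> carrier (grp S (Suc 0))" "face S 0 0 w = \<one>\<^bsub>grp S 0\<^esub>"
    and h: "h = face S 0 (Suc 0) w"
    by (auto simp: boundaries_0 kernel_def)
  let ?w = "degen S 0 0 x \<otimes>\<^bsub>grp S (Suc 0)\<^esub> w \<otimes>\<^bsub>grp S (Suc 0)\<^esub> inv\<^bsub>grp S (Suc 0)\<^esub> degen S 0 0 x"
  have "?w \<in> kernel (grp S (Suc 0)) (grp S 0) (face S 0 0)"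
    using w x by (simp add: kernel_def)
  moreover have "x \<otimes>\<^bsub>grp S 0\<^esub> h \<otimes>\<^bsub>grp S 0\<^esub> inv\<^bsub>grp S 0\<^esub> x = face S 0 (Suc 0) ?w"
    using w x by (simp add: h)
  ultimately show "x \<otimes>\<^bsub>grp S 0\<^esub> h \<otimes>\<^bsub>grp S 0\<^esub> inv\<^bsub>grp S 0\<^esub> x \<in> B"
    unfolding boundaries_0 by blast
qed

text \<open>There is no face to vanish in degree 0: the condition \<open>n = Suc m\<close> never
  holds, so every element is a cycle.\<close>

lemma homotopy_grp_0: "homotopy_grp S 0 = grp S 0 Mod B"
proof -
  have "moore_cycles S 0 = carrier (grp S 0)"
    by (simp add: moore_cycles_def)
  then show ?thesis by (simp add: homotopy_grp_def)
qed

lemma aug_hom: "aug S \<theta> \<in> hom (grp S 0) K"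
proof -
  have "\<theta> \<in> hom (grp S 0 Mod B) K"
    using iso by (simp add: homotopy_grp_0 iso_def)
  from Group.hom_compose[OF normal.r_coset_hom_Mod[OF boundaries_normal] this]
  show ?thesis by (simp add: comp_def aug_def[abs_def])
qed

lemma aug_surj: "aug S \<theta> ` carrier (grp S 0) = carrier K"
proof -
  have "\<theta> ` carrier (grp S 0 Mod B) = carrier K"
    using iso by (simp add: homotopy_grp_0 iso_def bij_betw_def)
  then show ?thesis
    by (simp add: carrier_FactGroup aug_def[abs_def] image_image)
qed

text \<open>The fibres of the augmentation are cosets of \<open>B\<close>. Multiplying on the right
  by \<open>s0 x\<close> or by its inverse passes between an element of the kernel of
  \<open>d0\<close> with \<open>d1\<close>-image \<open>y\<close> times the inverse of
  \<open>x\<close> and an element with faces \<open>x\<close> and \<open>y\<close>. Thus the pairs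
  of faces already form an equivalence relation.\<close>

lemma aug_eq_iff:
  assumes x: "x \<in> carrier (grp S 0)" and y: "y \<in> carrier (grp S 0)"
  shows "aug S \<theta> x = aug S \<theta> y \<longleftrightarrow>
    (\<exists>w\<in>carrier (grp S (Suc 0)). face S 0 0 w = x \<and> face S 0 (Suc 0) w = y)"
proof -
  have sub: "subgroup B (grp S 0)" using boundaries_normal by (simp add: normal_def)
  have inj: "inj_on \<theta> (carrier (grp S 0 Mod B))"
    using iso by (simp add: homotopy_grp_0 iso_def bij_betw_def)
  have "aug S \<theta> x = aug S \<theta> y \<longleftrightarrow> B #>\<^bsub>grp S 0\<^esub> x = B #>\<^bsub>grp S 0\<^esub> y"
    using inj_onD[OF inj, of "B #>\<^bsub>grp S 0\<^esub> x" "B #>\<^bsub>grp S 0\<^esub> y"] x y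
    by (auto simp: aug_def carrier_FactGroup)
  also have "\<dots> \<longleftrightarrow> y \<in> B #>\<^bsub>grp S 0\<^esub> x"
    using d0.H.repr_independence[OF _ x sub, of y] d0.H.repr_independenceD[OF sub y, of x]
    by blast
  also have "\<dots> \<longleftrightarrow> (\<exists>w\<in>carrier (grp S (Suc 0)). face S 0 0 w = x \<and> face S 0 (Suc 0) w = y)"
  proof
    assume "y \<in> B #>\<^bsub>grp S 0\<^esub> x"
    then obtain u where u: "u \<in> carrier (grp S (Suc 0))" "face S 0 0 u = \<one>\<^bsub>grp S 0\<^esub>"
      "y = face S 0 (Suc 0) u \<otimes>\<^bsub>grp S 0\<^esub> x"
      by (auto simp: boundaries_0 kernel_def r_coset_def)
    then show "\<exists>w\<in>carrier (grp S (Suc 0)). face S 0 0 w = x \<and> face S 0 (Suc 0) w = y"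
      using x by (intro bexI[of _ "u \<otimes>\<^bsub>grp S (Suc 0)\<^esub> degen S 0 0 x"]) simp_all
  next
    assume "\<exists>w\<in>carrier (grp S (Suc 0)). face S 0 0 w = x \<and> face S 0 (Suc 0) w = y"
    then obtain w where w: "w \<in> carrier (grp S (Suc 0))" "face S 0 0 w = x"
      "face S 0 (Suc 0) w = y" by blast
    let ?u = "w \<otimes>\<^bsub>grp S (Suc 0)\<^esub> inv\<^bsub>grp S (Suc 0)\<^esub> degen S 0 0 x"
    have "?u \<in> kernel (grp S (Suc 0)) (grp S 0) (face S 0 0)"
      using w x by (simp add: kernel_def)
    then have "face S 0 (Suc 0) ?u \<in> B" unfolding boundaries_0 by blast
    moreover have "y = face S 0 (Suc 0) ?u \<otimes>\<^bsub>grp S 0\<^esub> x"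
      using w x y by (simp add: d0.H.m_assoc)
    ultimately show "y \<in> B #>\<^bsub>grp S 0\<^esub> x" by (auto simp: r_coset_def)
  qed
  finally show ?thesis .
qed

end

section \<open>The obstruction\<close>

locale abel_resolution = nil2_group G + resolution S \<theta> "abel G"
  for G :: "'a monoid" (structure) and S :: "'k simp_grp" and \<theta> :: "'k set \<Rightarrow> 'a set"
begin

sublocale simplicial_coefficients G S
  using simplicial by unfold_locales

section \<open>Lifts of the augmentation and their difference cochains\<close>

lemma q_lifts_iff: "\<phi> \<in> q_lifts S \<theta> G id \<longleftrightarrow> q_map (grp S 0) G \<phi> \<and>
    (\<forall>x\<in>carrier (grp S 0). abel_proj G (\<phi> x) = aug S \<theta> x)"
  by (simp add: q_lifts_def)

lemma q_lifts_closed: "\<phi> \<in> q_lifts S \<theta> G id \<Longrightarrow> x \<in> carrier (grp S 0) \<Longrightarrow> \<phi> x \<in> carrier G"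
  using q_map_closed by (auto simp: q_lifts_iff)

lemma q_lifts_nonempty: "q_lifts S \<theta> G id \<noteq> {}"
proof -
  have "group (abel G)" using comm_group_abel by (simp add: comm_group_def)
  then obtain h where "h \<in> hom (grp S 0) G"
    "\<And>x. x \<in> carrier (grp S 0) \<Longrightarrow> abel_proj G (h x) = aug S \<theta> x"
    using free_nil2_lift[OF free nil2 _ abel_proj_hom abel_proj_surj aug_hom] by blast
  then have "h \<in> q_lifts S \<theta> G id"
    using q_map_hom[OF nil2_S] by (simp add: q_lifts_iff)
  then show ?thesis by blast
qed

lemma lift_diff_closed:
  assumes \<phi>: "\<phi> \<in> q_lifts S \<theta> G id"
  shows "lift_diff S G \<phi> \<in> carrier (Quad (grp S 1))"
proof -
  have q: "q_map (grp S 0) G \<phi>" using \<phi> by (simp add: q_lifts_iff)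
  \<comment> \<open>The element \<open>x\<close> itself witnesses that its two faces have the same
    augmentation, so their lifted values agree modulo \<open>D\<close>.\<close>
  have D: "inv \<phi> (face S 0 0 x) \<otimes> \<phi> (face S 0 (Suc 0) x) \<in> D" if "x \<in> carrier (grp S (Suc 0))" for x
    using \<phi> that aug_eq_iff[of "face S 0 0 x" "face S 0 (Suc 0) x"]
      abel_proj_eq_iff[of "\<phi> (face S 0 0 x)" "\<phi> (face S 0 (Suc 0) x)"] q_lifts_closed[OF \<phi>]
    by (auto simp: q_lifts_iff)
  have "(\<lambda>x\<in>carrier (grp S (Suc 0)). inv \<phi> (face S 0 0 x) \<otimes> \<phi> (face S 0 (Suc 0) x))
      \<in> carrier (Quad (grp S (Suc 0)))"
    by (intro restrict_in_Quad q_map_divide q_map_comp[OF q nil2_S] d0.homh d1.homh funcsetI D)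
  then show ?thesis by (simp add: lift_diff_def)
qed

lemma lift_diff_cocycle:
  assumes \<phi>: "\<phi> \<in> q_lifts S \<theta> G id"
  shows "lift_diff S G \<phi> \<in> quad_cocycles S A 1"
proof -
  let ?z = "lift_diff S G \<phi>"
  have "?z (face S 1 0 x) \<otimes> inv (?z (face S 1 1 x)) \<otimes> ?z (face S 1 (Suc 1) x) = \<one>"
    if x: "x \<in> carrier (grp S (Suc 1))" for x
  proof -
    \<comment> \<open>The values of the lift at the three vertices of the 2-simplex
      \<open>x\<close>.\<close>
    let ?a = "\<phi> (face S 0 0 (face S (Suc 0) 0 x))"
    let ?b = "\<phi> (face S 0 (Suc 0) (face S (Suc 0) 0 x))"
    let ?c = "\<phi> (face S 0 (Suc 0) (face S (Suc 0) (Suc 0) x))"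
    have f: "face S (Suc 0) j x \<in> carrier (grp S (Suc 0))" if "j \<le> Suc (Suc 0)" for j
      using face_closed[OF that, of x] x by simp
    note ss = simplicial_nil2D(4)[OF simplicial, of _ 0 _ x]
    have "?a \<in> carrier G" "?b \<in> carrier G" "?c \<in> carrier G"
      using f by (auto intro!: q_lifts_closed[OF \<phi>] d0.hom_closed d1.hom_closed)
    moreover have "inv ?a \<otimes> ?b \<in> D"
    proof -
      have "?z (face S 1 0 x) \<in> D"
        using Quad_closed[OF nil2_S lift_diff_closed[OF \<phi>]] f[of 0] by simp
      then show ?thesis using f[of 0] by (simp add: lift_diff_def)
    qed
    ultimately have "(inv ?a \<otimes> ?b) \<otimes> inv (inv ?a \<otimes> ?c) \<otimes> (inv ?b \<otimes> ?c) = \<one>"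
      by (rule triple_cancel)
    \<comment> \<open>The remaining three double faces are the same vertices, so the alternating
      product has the form of \<open>triple_cancel\<close>.\<close>
    moreover have "face S 0 0 (face S (Suc 0) (Suc 0) x) = face S 0 0 (face S (Suc 0) 0 x)"
      "face S 0 0 (face S (Suc 0) (Suc (Suc 0)) x) = face S 0 (Suc 0) (face S (Suc 0) 0 x)"
      "face S 0 (Suc 0) (face S (Suc 0) (Suc (Suc 0)) x)
        = face S 0 (Suc 0) (face S (Suc 0) (Suc 0) x)"
      using ss[of "Suc 0" 0] ss[of "Suc (Suc 0)" 0] ss[of "Suc (Suc 0)" "Suc 0"] x by simp_all
    ultimately show ?thesis
      using f by (simp add: lift_diff_def)
  qed
  then have "quad_diff S A 1 ?z = \<one>\<^bsub>Quad (grp S (Suc 1))\<^esub>"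
    unfolding quad_diff_1[OF lift_diff_closed[OF \<phi>]] one_Quad by (intro restrict_ext)
  then show ?thesis
    using lift_diff_closed[OF \<phi>] by (simp add: quad_cocycles_def kernel_def)
qed

lemma q_lifts_twist:
  assumes \<phi>: "\<phi> \<in> q_lifts S \<theta> G id" and \<alpha>: "\<alpha> \<in> carrier (Quad (grp S 0))"
  shows "(\<lambda>x. \<phi> x \<otimes> \<alpha> x) \<in> q_lifts S \<theta> G id"
proof -
  interpret p: group_hom G "abel G" "abel_proj G" by (rule group_hom_abel_proj)
  have "abel_proj G (\<phi> x \<otimes> \<alpha> x) = abel_proj G (\<phi> x)" if "x \<in> carrier (grp S 0)" for x
    using that Quad_closed[OF nil2_S \<alpha>, of x] q_lifts_closed[OF \<phi>]
      abel_proj_eq_one_iff[of "\<alpha> x"] by simp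
  then show ?thesis
    using \<phi> \<alpha> q_map_mult[of "grp S 0" \<phi> \<alpha>] by (simp add: q_lifts_iff carrier_Quad[OF nil2_S])
qed

text \<open>Because \<open>quad_diff\<close> and \<open>lift_diff\<close> have opposite signs, the
  coboundary stands on the side of the twisted lift.\<close>

lemma lift_diff_twist:
  assumes \<phi>: "\<phi> \<in> q_lifts S \<theta> G id" and \<alpha>: "\<alpha> \<in> carrier (Quad (grp S 0))"
  shows "lift_diff S G \<phi> =
    quad_diff S A 0 \<alpha> \<otimes>\<^bsub>Quad (grp S 1)\<^esub> lift_diff S G (\<lambda>x. \<phi> x \<otimes> \<alpha> x)"
proof -
  have "(\<alpha> (face S 0 0 x) \<otimes> inv \<alpha> (face S 0 (Suc 0) x)) \<otimes>
      (inv (\<phi> (face S 0 0 x) \<otimes> \<alpha> (face S 0 0 x)) \<otimes>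
        (\<phi> (face S 0 (Suc 0) x) \<otimes> \<alpha> (face S 0 (Suc 0) x))) =
      inv \<phi> (face S 0 0 x) \<otimes> \<phi> (face S 0 (Suc 0) x)"
    if x: "x \<in> carrier (grp S (Suc 0))" for x
  proof -
    have cl: "\<phi> (face S 0 0 x) \<in> carrier G" "\<phi> (face S 0 (Suc 0) x) \<in> carrier G"
      "\<alpha> (face S 0 0 x) \<in> D" "\<alpha> (face S 0 (Suc 0) x) \<in> D"
      using x by (auto intro: q_lifts_closed[OF \<phi>] Quad_closed[OF nil2_S \<alpha>])
    then show ?thesis by (rule twist_cancel)
  qed
  then show ?thesis
    unfolding quad_diff_0[OF \<alpha>] lift_diff_def mult_Quad by (auto intro!: restrict_ext)
qed

lemma quad_class_lift_diff_unique:
  assumes \<phi>: "\<phi> \<in> q_lifts S \<theta> G id" and \<phi>': "\<phi>' \<in> q_lifts S \<theta> G id"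
  shows "quad_class S A 1 (lift_diff S G \<phi>) = quad_class S A 1 (lift_diff S G \<phi>')"
proof -
  \<comment> \<open>The twist carrying \<open>\<phi>\<close> to \<open>\<phi>'\<close>. It is
    \<open>D\<close>-valued since both lifts project to the augmentation, and quadratic by
    \<open>q_map_divide\<close>.\<close>
  define \<alpha> where "\<alpha> = (\<lambda>x\<in>carrier (grp S 0). inv (\<phi> x) \<otimes> \<phi>' x)"
  have D: "inv (\<phi> x) \<otimes> \<phi>' x \<in> D" if "x \<in> carrier (grp S 0)" for x
    using that \<phi> \<phi>' abel_proj_eq_iff[of "\<phi> x" "\<phi>' x"] q_lifts_closed[OF \<phi>] q_lifts_closed[OF \<phi>']
    by (simp add: q_lifts_iff)
  then have \<alpha>: "\<alpha> \<in> carrier (Quad (grp S 0))"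
    unfolding \<alpha>_def using \<phi> \<phi>' by (intro restrict_in_Quad q_map_divide) (auto simp: q_lifts_iff)
  have "\<phi> x \<otimes> \<alpha> x = \<phi>' x" if "x \<in> carrier (grp S 0)" for x
    using that q_lifts_closed[OF \<phi>] q_lifts_closed[OF \<phi>'] by (simp add: \<alpha>_def m_assoc[symmetric])
  \<comment> \<open>The twisted lift and \<open>\<phi>'\<close> are known to agree only on the
    carrier, which contains all faces at which \<open>lift_diff\<close> evaluates them.\<close>
  then have "lift_diff S G (\<lambda>x. \<phi> x \<otimes> \<alpha> x) = lift_diff S G \<phi>'"
    by (auto simp: lift_diff_def intro!: restrict_ext)
  then show ?thesis
    using quad_class_eqI[OF \<alpha> lift_diff_closed[OF \<phi>']] lift_diff_twist[OF \<phi> \<alpha>] by simp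
qed

text \<open>Independence of the lift makes \<open>the_elem\<close> in \<open>connecting\<close>
  meaningful.\<close>

lemma connecting_values_eq:
  assumes "\<phi> \<in> q_lifts S \<theta> G id"
  shows "connecting_values S \<theta> G id = {quad_class S A 1 (lift_diff S G \<phi>)}"
  unfolding connecting_values_def using assms quad_class_lift_diff_unique by blast

lemma obstruction_eq:
  assumes "\<phi> \<in> q_lifts S \<theta> G id"
  shows "obstruction S \<theta> G = quad_class S A 1 (lift_diff S G \<phi>)"
  by (simp add: obstruction_def connecting_def connecting_values_eq[OF assms])

lemma quad_class_in_quad_coh:
  assumes "z \<in> quad_cocycles S A 1"
  shows "quad_class S A 1 z \<in> carrier (quad_coh S A 1)"
  using assms by (auto simp: quad_coh_def quad_class_def carrier_FactGroup r_coset_def)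

text \<open>Elements with equal augmentation are joined by an element of degree 1, so
  \<open>\<phi>\<close> is constant on the fibres and factors as \<open>s\<close> after the
  augmentation. The augmentation is a surjective homomorphism, so bilinearity of the cross effect
  descends from \<open>\<phi>\<close> to \<open>s\<close>.\<close>

lemma q_split_if_lift_equalizes:
  assumes \<phi>: "\<phi> \<in> q_lifts S \<theta> G id"
    and eq: "\<And>x. x \<in> carrier (grp S (Suc 0)) \<Longrightarrow> \<phi> (face S 0 0 x) = \<phi> (face S 0 (Suc 0) x)"
  shows "q_split G"
proof -
  have "\<forall>c\<in>carrier (abel G). \<exists>x. x \<in> carrier (grp S 0) \<and> aug S \<theta> x = c"
    using aug_surj by (metis imageE)
  then obtain t where t: "\<And>c. c \<in> carrier (abel G) \<Longrightarrow> t c \<in> carrier (grp S 0)"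
    "\<And>c. c \<in> carrier (abel G) \<Longrightarrow> aug S \<theta> (t c) = c"
    by metis
  define s where "s c = \<phi> (t c)" for c
  interpret ab: comm_group "abel G" by (rule comm_group_abel)
  have s_aug: "s (aug S \<theta> x) = \<phi> x" if x: "x \<in> carrier (grp S 0)" for x
  proof -
    have c: "aug S \<theta> x \<in> carrier (abel G)" using x aug_surj by blast
    then obtain w where "w \<in> carrier (grp S (Suc 0))" "face S 0 0 w = t (aug S \<theta> x)"
      "face S 0 (Suc 0) w = x"
      using aug_eq_iff[OF t(1)[OF c] x] t(2)[OF c] by blast
    then show ?thesis using eq[of w] by (simp add: s_def)
  qed
  \<comment> \<open>The set-theoretic section \<open>t\<close> need not be additive;
    \<open>t c\<close> times \<open>t c'\<close> serves as another representative of the product of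
    \<open>c\<close> and \<open>c'\<close>.\<close>
  have mult: "t c \<otimes>\<^bsub>grp S 0\<^esub> t c' \<in> carrier (grp S 0)"
    "aug S \<theta> (t c \<otimes>\<^bsub>grp S 0\<^esub> t c') = c \<otimes>\<^bsub>abel G\<^esub> c'"
    if "c \<in> carrier (abel G)" "c' \<in> carrier (abel G)" for c c'
    using that t aug_hom by (simp_all add: hom_mult)
  have cross: "cross (abel G) G s c c' = cross (grp S 0) G \<phi> (t c) (t c')"
    if "c \<in> carrier (abel G)" "c' \<in> carrier (abel G)" for c c'
    using s_aug[OF mult(1)[OF that]] mult(2)[OF that] by (simp add: cross_def s_def)
  have cross_aug: "cross (abel G) G s (aug S \<theta> x) (aug S \<theta> y) = cross (grp S 0) G \<phi> x y"
    if "x \<in> carrier (grp S 0)" "y \<in> carrier (grp S 0)" for x y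
    using that s_aug[OF d0.H.m_closed[OF that]] aug_hom by (simp add: cross_def s_aug hom_mult)
  have bil: "bilinear_on (grp S 0) (cross (grp S 0) G \<phi>)"
    using \<phi> by (simp add: q_lifts_iff q_map_iff)
  have "bilinear_on (abel G) (cross (abel G) G s)"
    unfolding bilinear_on_def
  proof (intro conjI ballI)
    fix c c' c'' assume c: "c \<in> carrier (abel G)" "c' \<in> carrier (abel G)" "c'' \<in> carrier (abel G)"
    show "cross (abel G) G s (c \<otimes>\<^bsub>abel G\<^esub> c') c'' =
        cross (abel G) G s c c'' \<otimes> cross (abel G) G s c' c''"
      using bil c t(1) cross_aug[OF mult(1)[OF c(1,2)] t(1)[OF c(3)]]
      by (simp add: bilinear_on_def cross mult t(2))
    show "cross (abel G) G s c (c' \<otimes>\<^bsub>abel G\<^esub> c'') =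
        cross (abel G) G s c c' \<otimes> cross (abel G) G s c c''"
      using bil c t(1) cross_aug[OF t(1)[OF c(1)] mult(1)[OF c(2,3)]]
      by (simp add: bilinear_on_def cross mult t(2))
  next
    fix c c' assume c: "c \<in> carrier (abel G)" "c' \<in> carrier (abel G)"
    show "cross (abel G) G s c c' \<in> D"
      using bil c t(1) by (simp add: bilinear_on_def cross)
  qed
  moreover have "s c \<in> carrier G" if "c \<in> carrier (abel G)" for c
    using q_lifts_closed[OF \<phi> t(1)[OF that]] by (simp add: s_def)
  ultimately have "q_map (abel G) G s"
    using nil2_if_comm_group[OF comm_group_abel] by (simp add: q_map_iff)
  moreover have "abel_proj G (s c) = c" if "c \<in> carrier (abel G)" for c
    using \<phi> t that by (simp add: s_def q_lifts_iff)
  ultimately show ?thesis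
    using nil2 q_map_imp_quadratic unfolding q_split_def by blast
qed

text \<open>The lift is the section composed with the augmentation, which does not distinguish the
  two faces.\<close>

lemma q_split_imp_lift:
  assumes "q_split G"
  obtains \<phi> where "\<phi> \<in> q_lifts S \<theta> G id"
    "\<And>x. x \<in> carrier (grp S (Suc 0)) \<Longrightarrow> \<phi> (face S 0 0 x) = \<phi> (face S 0 (Suc 0) x)"
proof -
  obtain s where s: "quadratic (abel G) G s"
    and sec: "\<And>c. c \<in> carrier (abel G) \<Longrightarrow> abel_proj G (s c) = c"
    using assms by (auto simp: q_split_def)
  have s': "weakly_quadratic (abel G) G s" using s by (simp add: quadratic_def)
  then have cl: "s c \<in> carrier G" if "c \<in> carrier (abel G)" for c
    using that by (auto simp: weakly_quadratic_def)
  interpret ab: comm_group "abel G" by (rule comm_group_abel)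
  interpret p: group_hom G "abel G" "abel_proj G" by (rule group_hom_abel_proj)
  \<comment> \<open>\<open>abel_proj G \<circ> s\<close> is the identity on the abelianization,
    hence additive there, so the cross effect of \<open>s\<close> projects to one. This makes the
    quadratic section a q-map.\<close>
  have "cross (abel G) G s c c' \<in> D" if "c \<in> carrier (abel G)" "c' \<in> carrier (abel G)" for c c'
    unfolding cross_def
    using that cl sec abel_proj_eq_iff[of "s c \<otimes> s c'" "s (c \<otimes>\<^bsub>abel G\<^esub> c')"] by simp
  then have q: "q_map (abel G) G s"
    using s' nil2 nil2_if_comm_group[OF comm_group_abel] by (simp add: q_map_def)
  show thesis
  proof
    show "(\<lambda>x. s (aug S \<theta> x)) \<in> q_lifts S \<theta> G id"
      using q_map_comp[OF q nil2_S aug_hom] sec aug_hom by (auto simp: q_lifts_iff hom_def)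
    show "s (aug S \<theta> (face S 0 0 x)) = s (aug S \<theta> (face S 0 (Suc 0) x))"
      if "x \<in> carrier (grp S (Suc 0))" for x
      using that aug_eq_iff[of "face S 0 0 x" "face S 0 (Suc 0) x"] by auto
  qed
qed

lemma obstruction_eq_one_iff: "obstruction S \<theta> G = \<one>\<^bsub>quad_coh S A 1\<^esub> \<longleftrightarrow> q_split G"
proof -
  interpret Q: comm_group "Quad (grp S 1)" using comm_group_Quad[OF nil2_S] .
  interpret Q0: comm_group "Quad (grp S 0)" using comm_group_Quad[OF nil2_S] .
  interpret \<delta>: group_hom "Quad (grp S 0)" "Quad (grp S 1)" "quad_diff S A 0"
    using quad_diff_0_hom by unfold_locales
  show ?thesis
  proof
    assume o: "obstruction S \<theta> G = \<one>\<^bsub>quad_coh S A 1\<^esub>"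
    obtain \<phi> where \<phi>: "\<phi> \<in> q_lifts S \<theta> G id" using q_lifts_nonempty by blast
    obtain \<alpha> where \<alpha>: "\<alpha> \<in> carrier (Quad (grp S 0))" "lift_diff S G \<phi> = quad_diff S A 0 \<alpha>"
      using o quad_class_eq_one_iff[OF lift_diff_closed[OF \<phi>]] obstruction_eq[OF \<phi>] by auto
    let ?\<psi> = "\<lambda>x. \<phi> x \<otimes> \<alpha> x"
    have \<psi>: "?\<psi> \<in> q_lifts S \<theta> G id" by (rule q_lifts_twist[OF \<phi> \<alpha>(1)])
    \<comment> \<open>Twisting by \<open>\<alpha>\<close> removes the coboundary:
      \<open>lift_diff_twist\<close> equates \<open>quad_diff S A 0 \<alpha>\<close> with its
      product by the difference of the twisted lift, which must be trivial.\<close>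
    have "lift_diff S G ?\<psi> = \<one>\<^bsub>Quad (grp S 1)\<^esub>"
      using lift_diff_twist[OF \<phi> \<alpha>(1)] \<alpha>(2) \<delta>.hom_closed[OF \<alpha>(1)] lift_diff_closed[OF \<psi>]
        Q.l_cancel_one[of "quad_diff S A 0 \<alpha>" "lift_diff S G ?\<psi>"] by simp
    then have one: "inv ?\<psi> (face S 0 0 x) \<otimes> ?\<psi> (face S 0 (Suc 0) x) = \<one>"
      if "x \<in> carrier (grp S (Suc 0))" for x
      using that by (auto simp: lift_diff_def one_Quad dest: fun_cong[of _ _ x])
    show "q_split G"
    proof (rule q_split_if_lift_equalizes[OF \<psi>])
      fix x assume x: "x \<in> carrier (grp S (Suc 0))"
      show "?\<psi> (face S 0 0 x) = ?\<psi> (face S 0 (Suc 0) x)"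
        using one[OF x] q_lifts_closed[OF \<psi>] x
          inv_solve_left'[of \<one> "?\<psi> (face S 0 0 x)" "?\<psi> (face S 0 (Suc 0) x)"] by simp
    qed
  next
    assume "q_split G"
    from q_split_imp_lift[OF this] obtain \<phi> where \<phi>: "\<phi> \<in> q_lifts S \<theta> G id"
      "\<And>x. x \<in> carrier (grp S (Suc 0)) \<Longrightarrow> \<phi> (face S 0 0 x) = \<phi> (face S 0 (Suc 0) x)"
      by metis
    have "lift_diff S G \<phi> = \<one>\<^bsub>Quad (grp S 1)\<^esub>"
      using \<phi>(2) q_lifts_closed[OF \<phi>(1)]
      by (auto simp: lift_diff_def one_Quad intro!: restrict_ext)
    \<comment> \<open>The trivial cochain is the coboundary of the trivial cochain.\<close>
    then show "obstruction S \<theta> G = \<one>\<^bsub>quad_coh S A 1\<^esub>"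
      using quad_class_eq_one_iff[OF lift_diff_closed[OF \<phi>(1)]] obstruction_eq[OF \<phi>(1)]
        \<delta>.hom_one Q0.one_closed by metis
  qed
qed

text \<open>A lift over \<open>T\<close> composed with \<open>g 0\<close> is a lift over
  \<open>S\<close>, and pulling back along \<open>g\<close> commutes with both
  \<open>lift_diff\<close> and \<open>quad_diff\<close>.\<close>

lemma obstruction_natural:
  fixes T :: "'l simp_grp"
  assumes T: "free_resolution T \<eta> (abel G)" and g: "simp_map S T g"
    and aug: "\<And>x. x \<in> carrier (grp S 0) \<Longrightarrow> aug T \<eta> (g 0 x) = aug S \<theta> x"
  shows "quad_coh_map S A g 1 (obstruction T \<eta> G) = obstruction S \<theta> G"
proof -
  interpret T: abel_resolution G T \<eta>
    using T by unfold_locales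
  have g_hom: "g n \<in> hom (grp S n) (grp T n)" for n
    using g by (simp add: simp_map_def)
  have g_cl: "g n x \<in> carrier (grp T n)" if "x \<in> carrier (grp S n)" for n x
    using g_hom that by (auto simp: hom_def)
  have g_face: "face T 0 i (g (Suc 0) x) = g 0 (face S 0 i x)"
    if "i \<le> 1" "x \<in> carrier (grp S (Suc 0))" for i x
    using g that by (simp add: simp_map_def)
  obtain \<phi> where \<phi>: "\<phi> \<in> q_lifts T \<eta> G id" using T.q_lifts_nonempty by blast
  let ?\<phi> = "\<lambda>x. \<phi> (g 0 x)"
  have \<phi>': "?\<phi> \<in> q_lifts S \<theta> G id"
    using \<phi> q_map_comp[OF _ nil2_S g_hom] aug g_cl by (simp add: q_lifts_iff T.q_lifts_iff)
  \<comment> \<open>The induced map is a union over all representatives, so each one, not only the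
    difference of the chosen lift, must yield the same class.\<close>
  have pull: "quad_class S A 1 (\<lambda>x\<in>carrier (grp S 1). z (g 1 x)) = obstruction S \<theta> G"
    if mem: "z \<in> obstruction T \<eta> G" for z
  proof -
    obtain \<alpha> where \<alpha>: "\<alpha> \<in> carrier (Quad (grp T 0))"
      and z: "z = quad_diff T A 0 \<alpha> \<otimes>\<^bsub>Quad (grp T 1)\<^esub> lift_diff T G \<phi>"
      using mem unfolding T.obstruction_eq[OF \<phi>] quad_class_def T.coboundaries_1 r_coset_def by blast
    define \<beta> where "\<beta> = (\<lambda>x\<in>carrier (grp S 0). \<alpha> (g 0 x))"
    have \<beta>: "\<beta> \<in> carrier (Quad (grp S 0))"
      unfolding \<beta>_def by (rule Quad_comp[OF nil2_S T.nil2_S g_hom \<alpha>])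
    have "(\<lambda>x\<in>carrier (grp S 1). z (g 1 x)) = quad_diff S A 0 \<beta> \<otimes>\<^bsub>Quad (grp S 1)\<^esub> lift_diff S G ?\<phi>"
      unfolding z T.quad_diff_0[OF \<alpha>] quad_diff_0[OF \<beta>] lift_diff_def mult_Quad
      by (auto simp: g_cl g_face \<beta>_def intro!: restrict_ext)
    then show ?thesis
      using quad_class_eqI[OF \<beta> lift_diff_closed[OF \<phi>']] obstruction_eq[OF \<phi>'] by simp
  qed
  \<comment> \<open>Without a representative that union would be empty.\<close>
  moreover have "obstruction T \<eta> G \<noteq> {}"
  proof -
    interpret Q: comm_group "Quad (grp T 1)" using comm_group_Quad[OF T.nil2_S] .
    show ?thesis
      unfolding T.obstruction_eq[OF \<phi>] quad_class_def
      using Q.rcos_self[OF T.lift_diff_closed[OF \<phi>] T.coboundaries_subgroup] by blast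
  qed
  ultimately show ?thesis
    unfolding quad_coh_map_def by auto
qed

end

text \<open>Being well defined has several facets here: the lift differences are cocycles, all lifts
  give one class, and that class is respected by simplicial maps compatible with the augmentations,
  where \<open>T\<close> may have another element type.\<close>

theorem corollary9p5:
  fixes G :: "'a monoid" and S :: "'k simp_grp" and \<theta> :: "'k set \<Rightarrow> 'a set"
  assumes "nil2 G"
    and "free_resolution S \<theta> (abel G)"
  shows "obstruction S \<theta> G \<in> carrier (quad_coh S (derived_group G) 1) \<and>
    connecting_values S \<theta> G id = {obstruction S \<theta> G} \<and>
    (\<forall>\<phi>\<in>q_lifts S \<theta> G id. lift_diff S G \<phi> \<in> quad_cocycles S (derived_group G) 1) \<and>
    (\<forall>(T :: 'l simp_grp) \<eta> g.
       free_resolution T \<eta> (abel G) \<and> simp_map S T g \<and>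
       (\<forall>x\<in>carrier (grp S 0). aug T \<eta> (g 0 x) = aug S \<theta> x) \<longrightarrow>
       quad_coh_map S (derived_group G) g 1 (obstruction T \<eta> G) = obstruction S \<theta> G) \<and>
    (obstruction S \<theta> G = \<one>\<^bsub>quad_coh S (derived_group G) 1\<^esub> \<longleftrightarrow> q_split G)"
proof -
  interpret nil2_group G by (rule nil2_groupI) fact
  interpret abel_resolution G S \<theta> by unfold_locales fact
  obtain \<phi> where \<phi>: "\<phi> \<in> q_lifts S \<theta> G id" using q_lifts_nonempty by blast
  show ?thesis
  proof (intro conjI ballI allI impI)
    show "obstruction S \<theta> G \<in> carrier (quad_coh S (derived_group G) 1)"
      unfolding obstruction_eq[OF \<phi>]
      by (rule quad_class_in_quad_coh[OF lift_diff_cocycle[OF \<phi>]])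
    show "connecting_values S \<theta> G id = {obstruction S \<theta> G}"
      unfolding obstruction_eq[OF \<phi>] by (rule connecting_values_eq[OF \<phi>])
    show "lift_diff S G \<psi> \<in> quad_cocycles S (derived_group G) 1"
      if "\<psi> \<in> q_lifts S \<theta> G id" for \<psi>
      using that by (rule lift_diff_cocycle)
    show "quad_coh_map S (derived_group G) g 1 (obstruction T \<eta> G) = obstruction S \<theta> G"
      if "free_resolution T \<eta> (abel G) \<and> simp_map S T g \<and>
        (\<forall>x\<in>carrier (grp S 0). aug T \<eta> (g 0 x) = aug S \<theta> x)"
      for T :: "'l simp_grp" and \<eta> g
      using that by (intro obstruction_natural) blast+
    show "obstruction S \<theta> G = \<one>\<^bsub>quad_coh S (derived_group G) 1\<^esub> \<longleftrightarrow> q_split G"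
      by (rule obstruction_eq_one_iff)
  qed
qed

end
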